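(* For $h>0$ let $\mathcal{K}_h=\{K\in\mathcal{K}:\ \mathrm{Tr}(P_K-P^\star)\le h\}$. Given $K_0$, define the outer-loop iteration $K_{p+1}=R^{-1}B^\top P_{K_p}$ for $p=0,1,2,\dots$. Then for any $h>0$ and $K_0\in\mathcal{K}_h$ there exists $\alpha(h)\in[0,1)$ such that $\mathrm{Tr}(P_{K_{p+1}}-P^\star)\le\alpha(h)\,\mathrm{Tr}(P_{K_p}-P^\star)$ for all $p\in\mathbb{N}$; that is, $P^\star$ is an exponentially stable equilibrium of the iteration.
   Context: Let $A\in\mathbb{R}^{n\times n}$, $B\in\mathbb{R}^{n\times m}$, $C\in\mathbb{R}^{p\times n}$, $D\in\mathbb{R}^{n\times q}$, $E\in\mathbb{R}^{p\times m}$, $\gamma>0$, with $Q:=C^\top C\succ 0$, $E^\top C=0$, $R:=E^\top E\succ 0$. For $K\in\mathbb{R}^{m\times n}$ set $A_K=A-BK$, $Q_K=Q+K^\top RK$, $T_{zw}(K)(s)=(C-EK)(sI-A+BK)^{-1}D$, and $\mathcal{K}=\{K:\ A_K\text{ Hurwitz},\ \|T_{zw}(K)\|_{\mathcal{H}_\infty}<\gamma\}$, where $\|G\|_{\mathcal{H}_\infty}=\sup_{\omega\in\mathbb{R}}\bar\sigma(G(j\omega))$. For $K\in\mathcal{K}$, $P_K$ denotes the unique symmetric positive definite solution of $A_K^\top P+PA_K+Q_K+\gamma^{-2}PDD^\top P=0$ for which $A_K+\gamma^{-2}DD^\top P_K$ is Hurwitz. $P^\star$ denotes the unique symmetric positive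 definite (stabilizing) solution of $A^\top P+PA-P(BR^{-1}B^\top-\gamma^{-2}DD^\top)P+Q=0$. $\mathrm{Tr}$ is the trace. *)

theory Defs
  imports "HOL-Analysis.Analysis"
begin

definition cmat :: "real^'c^'r \<Rightarrow> complex^'c^'r" where
  "cmat M = (\<chi> i j. complex_of_real (M $ i $ j))"

definition hurwitz :: "real^'n^'n \<Rightarrow> bool" where
  "hurwitz M \<longleftrightarrow> (\<forall>z::complex. det (mat z - cmat M) = 0 \<longrightarrow> Re z < 0)"

definition sigma_max :: "complex^'c^'r \<Rightarrow> real" where
  "sigma_max G = Sup {norm (G *v x) | x. norm x = 1}"

definition hinf_norm :: "(real \<Rightarrow> complex^'c^'r) \<Rightarrow> ereal" where
  "hinf_norm G = (SUP \<omega>. ereal (sigma_max (G \<omega>)))"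

definition sym_mat :: "real^'n^'n \<Rightarrow> bool" where
  "sym_mat P \<longleftrightarrow> transpose P = P"

definition pos_def :: "real^'n^'n \<Rightarrow> bool" where
  "pos_def P \<longleftrightarrow> sym_mat P \<and> (\<forall>x. x \<noteq> 0 \<longrightarrow> x \<bullet> (P *v x) > 0)"

definition A_K :: "real^'n^'n \<Rightarrow> real^'m^'n \<Rightarrow> real^'n^'m \<Rightarrow> real^'n^'n" where
  "A_K A B K = A - B ** K"

definition Q_K :: "real^'n^'p \<Rightarrow> real^'m^'p \<Rightarrow> real^'n^'m \<Rightarrow> real^'n^'n" where
  "Q_K C E K = transpose C ** C + transpose K ** (transpose E ** E) ** K"

definition T_zw :: "real^'n^'n \<Rightarrow> real^'m^'n \<Rightarrow> real^'n^'p \<Rightarrow> real^'q^'n \<Rightarrow> real^'m^'p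
    \<Rightarrow> real^'n^'m \<Rightarrow> real \<Rightarrow> complex^'q^'p" where
  "T_zw A B C D E K \<omega> =
     cmat (C - E ** K) ** matrix_inv (mat (\<i> * complex_of_real \<omega>) - cmat (A_K A B K)) ** cmat D"

definition Kset :: "real^'n^'n \<Rightarrow> real^'m^'n \<Rightarrow> real^'n^'p \<Rightarrow> real^'q^'n \<Rightarrow> real^'m^'p
    \<Rightarrow> real \<Rightarrow> (real^'n^'m) set" where
  "Kset A B C D E \<gamma> = {K. hurwitz (A_K A B K) \<and> hinf_norm (T_zw A B C D E K) < ereal \<gamma>}"

definition P_K :: "real^'n^'n \<Rightarrow> real^'m^'n \<Rightarrow> real^'n^'p \<Rightarrow> real^'q^'n \<Rightarrow> real^'m^'p
    \<Rightarrow> real \<Rightarrow> real^'n^'m \<Rightarrow> real^'n^'n" where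
  "P_K A B C D E \<gamma> K = (THE P. pos_def P \<and>
      transpose (A_K A B K) ** P + P ** A_K A B K + Q_K C E K
        + (inverse (\<gamma>\<^sup>2)) *\<^sub>R (P ** D ** transpose D ** P) = 0 \<and>
      hurwitz (A_K A B K + (inverse (\<gamma>\<^sup>2)) *\<^sub>R (D ** transpose D ** P)))"

text \<open>Stabilizing solution of the game Riccati equation
  A^T P + P A - P (B R^-1 B^T - gamma^-2 D D^T) P + Q = 0.\<close>
definition is_Pstar :: "real^'n^'n \<Rightarrow> real^'m^'n \<Rightarrow> real^'n^'p \<Rightarrow> real^'q^'n \<Rightarrow> real^'m^'p
    \<Rightarrow> real \<Rightarrow> real^'n^'n \<Rightarrow> bool" where
  "is_Pstar A B C D E \<gamma> P \<longleftrightarrow> pos_def P \<and>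
      transpose A ** P + P ** A
        - P ** (B ** matrix_inv (transpose E ** E) ** transpose B - (inverse (\<gamma>\<^sup>2)) *\<^sub>R (D ** transpose D)) ** P
        + transpose C ** C = 0 \<and>
      hurwitz (A - (B ** matrix_inv (transpose E ** E) ** transpose B
                    - (inverse (\<gamma>\<^sup>2)) *\<^sub>R (D ** transpose D)) ** P)"

definition P_star :: "real^'n^'n \<Rightarrow> real^'m^'n \<Rightarrow> real^'n^'p \<Rightarrow> real^'q^'n \<Rightarrow> real^'m^'p
    \<Rightarrow> real \<Rightarrow> real^'n^'n" where
  "P_star A B C D E \<gamma> = (THE P. is_Pstar A B C D E \<gamma> P)"

definition Kset_h :: "real^'n^'n \<Rightarrow> real^'m^'n \<Rightarrow> real^'n^'p \<Rightarrow> real^'q^'n \<Rightarrow> real^'m^'p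
    \<Rightarrow> real \<Rightarrow> real \<Rightarrow> (real^'n^'m) set" where
  "Kset_h A B C D E \<gamma> h = {K \<in> Kset A B C D E \<gamma>.
      trace (P_K A B C D E \<gamma> K - P_star A B C D E \<gamma>) \<le> h}"

end

theory Submission
  imports Defs "HOL-Computational_Algebra.Fundamental_Theorem_Algebra"
begin

text \<open>For a stable matrix \<open>M\<close> the Lyapunov operator \<open>lyap M X = M\<^sup>T X + X M\<close> reverses signs: if
  \<open>lyap M X\<close> is negative semidefinite then \<open>X\<close> is positive semidefinite. Every comparison of
  Riccati solutions is read off from this.

  Hurwitz matrices have a Lyapunov certificate, and Riccati solutions exist below the \<open>H\<^sub>\<infinity>\<close>
  threshold, by continuation in a parameter: a limit of stable closed loops is stable unless it has
  an imaginary eigenvalue, and the latter is excluded by the spectral assumption or by the bound on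
  the transfer function.

  For the contraction put \<open>\<Delta> = P\<^sub>K - P\<^sup>\<star>\<close> and \<open>\<delta> = P\<^sub>K - P\<^sub>K\<^sub>'\<close> for the improved policy
  \<open>K'\<close>. The Lyapunov operator of the improved closed loop maps \<open>\<Delta> + c\<^sub>2 \<Delta>X\<Delta> - c\<^sub>3 \<delta>\<close>, for a fixed
  positive definite \<open>X\<close> and constants depending on \<open>h\<close> only, to a positive semidefinite matrix. Hence
  \<open>\<Delta> \<le> c\<^sub>3 \<delta>\<close>, and \<open>\<alpha> = 1 - 1 / c\<^sub>3\<close> works.\<close>

section \<open>Matrix algebra\<close>

text \<open>The game equation has the indefinite quadratic coefficient \<open>W - S\<close>, where
  \<open>W\<close> comes from the disturbance and \<open>S\<close> from the control. Comparison by
  convexity is available for policy equations, whose coefficient is \<open>W\<close> alone; for the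
  game equation, minimality is obtained by passing to inverses. The two kinds of equation meet in
  \<open>complete_square\<close>, whose excess Y is what a policy update gains. Why a term
  \<Delta>X\<Delta> is needed: to first order the improved closed loop sends both \<Delta> and
  \<delta> to -Y, but the image of \<Delta> also contains -\<Delta>S\<Delta>, for which Y gives no
  direct bound. The image of \<Delta>X\<Delta> is \<Delta>^2 up to terms carrying Y or \<delta>, so
  a multiple of it pays for that loss. Why the constants depend on h only: the trace of a
  semidefinite matrix bounds all its entries, so trace \<Delta> <= h bounds \<Delta>, and through
  the Riccati equation also Y. Stability is carried as a Lyapunov certificate, so that openness in a
  continuation is the perturbation of a strict inequality; only closedness needs spectral
  information.\<close>

lemma matrix_add_rdistrib: "(B + C) ** A = B ** A + C ** (A :: 'a::ring_1^'n^'m)"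
  by (vector matrix_matrix_mult_def sum.distrib algebra_simps)

lemma matrix_diff_ldistrib: "A ** (B - C) = A ** B - A ** (C :: 'a::ring_1^'n^'m)"
  by (vector matrix_matrix_mult_def sum_subtractf algebra_simps)

lemma matrix_diff_rdistrib: "(B - C) ** A = B ** A - C ** (A :: 'a::ring_1^'n^'m)"
  by (vector matrix_matrix_mult_def sum_subtractf algebra_simps)

lemma matrix_minus_left: "(- B) ** A = - (B ** (A :: 'a::ring_1^'n^'m))"
  by (vector matrix_matrix_mult_def sum_negf)

lemma matrix_minus_right: "B ** (- A) = - (B ** (A :: 'a::ring_1^'n^'m))"
  by (vector matrix_matrix_mult_def sum_negf)

lemma transpose_add: "transpose (A + B) = transpose A + transpose B"
  by (vector transpose_def)

lemma transpose_diff: "transpose (A - B) = transpose A - transpose B"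
  by (vector transpose_def)

lemma transpose_uminus: "transpose (- A) = - transpose A"
  by (vector transpose_def)

lemma transpose_zero: "transpose 0 = 0"
  by (vector transpose_def)

lemmas matrix_algebra = matrix_add_ldistrib matrix_add_rdistrib matrix_diff_ldistrib
  matrix_diff_rdistrib matrix_minus_left matrix_minus_right scalar_matrix_assoc[symmetric] matrix_scalar_ac
  transpose_add transpose_diff transpose_uminus transpose_scalar transpose_zero
  matrix_transpose_mul matrix_mul_assoc[symmetric] transpose_mat transpose_transpose
  matrix_mul_lid matrix_mul_rid

lemma matrix_vector_uminus: "(- A) *v x = - (A *v (x :: 'a::ring_1^'n))"
  by (vector matrix_vector_mult_def sum_negf)

lemma matrix_vector_scaleR_right: "A *v (c *\<^sub>R x) = c *\<^sub>R (A *v (x :: real^'n))"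
  by (simp add: linear_cmul)

lemmas matrix_vector_algebra = matrix_vector_mult_add_rdistrib matrix_vector_right_distrib
  matrix_vector_mult_diff_rdistrib matrix_vector_mult_diff_distrib matrix_vector_uminus
  scaleR_matrix_vector_assoc[symmetric] matrix_vector_scaleR_right matrix_vector_mul_assoc[symmetric]

lemma inner_matrix_vector: "x \<bullet> (A *v y) = (transpose A *v x) \<bullet> (y :: real^'n)"
  by (metis dot_lmul_matrix vector_transpose_matrix transpose_transpose)

lemma inner_transpose_vector: "x \<bullet> (transpose A *v y) = (A *v x) \<bullet> (y :: real^'n)"
  by (simp only: inner_matrix_vector[of x] transpose_transpose)

lemma inner_sym_mat: "sym_mat P \<Longrightarrow> x \<bullet> (P *v y) = (P *v x) \<bullet> (y :: real^'n)"
  by (simp add: sym_mat_def inner_matrix_vector)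

lemma sym_mat_intros [intro]:
  "sym_mat A \<Longrightarrow> sym_mat B \<Longrightarrow> sym_mat (A + B)"
  "sym_mat A \<Longrightarrow> sym_mat B \<Longrightarrow> sym_mat (A - B)"
  "sym_mat A \<Longrightarrow> sym_mat (- A)"
  "sym_mat A \<Longrightarrow> sym_mat (c *\<^sub>R A)"
  "sym_mat (mat k)" "sym_mat 0"
  by (auto simp: sym_mat_def matrix_algebra)

lemma norm_matrix_vector_bound:
  obtains c where "c > 0" "\<And>x. norm ((A :: real^'n^'m) *v x) \<le> c * norm x"
proof -
  have "linear ((*v) A)" by simp
  then obtain c where "c > 0" "\<forall>x. norm (A *v x) \<le> c * norm x"
    using linear_bounded_pos by blast
  then show ?thesis using that by blast
qed

lemma tendsto_matrix_mult [tendsto_intros]: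
  fixes f :: "'a \<Rightarrow> real^'n^'m" and g :: "'a \<Rightarrow> real^'k^'n"
  assumes "(f \<longlongrightarrow> a) F" "(g \<longlongrightarrow> b) F"
  shows "((\<lambda>x. f x ** g x) \<longlongrightarrow> a ** b) F"
  unfolding matrix_matrix_mult_def using assms by (intro tendsto_intros)

lemma tendsto_matrix_vector_mult [tendsto_intros]:
  fixes f :: "'a \<Rightarrow> real^'n^'m"
  assumes "(f \<longlongrightarrow> a) F" "(g \<longlongrightarrow> b) F"
  shows "((\<lambda>x. f x *v g x) \<longlongrightarrow> a *v b) F"
  unfolding matrix_vector_mult_def using assms by (intro tendsto_intros)

lemma tendsto_transpose [tendsto_intros]:
  fixes f :: "'a \<Rightarrow> real^'n^'m"
  assumes "(f \<longlongrightarrow> a) F"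
  shows "((\<lambda>x. transpose (f x)) \<longlongrightarrow> transpose a) F"
  unfolding transpose_def using assms by (intro tendsto_intros)

lemma matrix_norm_le_entries:
  fixes A :: "real^'n^'m"
  assumes "\<And>i j. \<bar>A $ i $ j\<bar> \<le> b"
  shows "norm A \<le> real CARD('m) * (real CARD('n) * b)"
proof -
  have "norm (A $ i) \<le> real CARD('n) * b" for i
    using norm_le_l1_cart[of "A $ i"] sum_bounded_above[of UNIV "\<lambda>j. \<bar>A $ i $ j\<bar>" b] assms
    by (simp add: order_trans)
  then have "(\<Sum>i\<in>UNIV. norm (A $ i)) \<le> real CARD('m) * (real CARD('n) * b)"
    using sum_bounded_above[of UNIV "\<lambda>i. norm (A $ i)" "real CARD('n) * b"] by simp
  moreover have "norm A \<le> (\<Sum>i\<in>UNIV. norm (A $ i))"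
    unfolding norm_vec_def by (intro L2_set_le_sum) auto
  ultimately show ?thesis by linarith
qed

lemma entry_eq_form: "axis i 1 \<bullet> (A *v axis j 1) = (A :: real^'n^'m) $ i $ j"
  by (simp add: inner_axis' matrix_vector_mult_basis column_def)

lemma tendsto_trace [tendsto_intros]:
  fixes f :: "'a \<Rightarrow> real^'n^'n"
  shows "(f \<longlongrightarrow> a) F \<Longrightarrow> ((\<lambda>x. trace (f x)) \<longlongrightarrow> trace a) F"
  unfolding trace_def by (intro tendsto_intros)

lemma trace_scaleR: "trace (c *\<^sub>R A) = c * trace (A :: real^'n^'n)"
  by (simp add: trace_def sum_distrib_left)

section \<open>Positive semidefinite matrices\<close>

definition psd :: "real^'n^'n \<Rightarrow> bool" where
  "psd P \<longleftrightarrow> sym_mat P \<and> (\<forall>x. 0 \<le> x \<bullet> (P *v x))"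

definition neg_form :: "real^'n^'n \<Rightarrow> bool" where
  "neg_form N \<longleftrightarrow> (\<forall>x. x \<noteq> 0 \<longrightarrow> x \<bullet> (N *v x) < 0)"

lemma psdD: "psd P \<Longrightarrow> 0 \<le> x \<bullet> (P *v x)"
  by (simp add: psd_def)

lemma psd_sym: "psd P \<Longrightarrow> sym_mat P"
  by (simp add: psd_def)

lemma psd_0: "psd 0"
  by (auto simp: psd_def)

lemma pos_def_psd: "pos_def P \<Longrightarrow> psd P"
  by (auto simp: psd_def pos_def_def) (metis inner_zero_left less_eq_real_def)

lemma psd_add: "psd A \<Longrightarrow> psd B \<Longrightarrow> psd (A + B)"
  by (auto simp: psd_def matrix_vector_algebra inner_add_right)

lemma psd_scaleR: "psd A \<Longrightarrow> c \<ge> 0 \<Longrightarrow> psd (c *\<^sub>R A)"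
  by (auto simp: psd_def matrix_vector_algebra)

lemma quadratic_congruence: "x \<bullet> ((transpose B ** A ** B) *v x) = (B *v x) \<bullet> (A *v (B *v (x :: real^'n)))"
proof -
  have "x \<bullet> ((transpose B ** A ** B) *v x) = x \<bullet> (transpose B *v (A *v (B *v x)))"
    by (simp add: matrix_vector_mul_assoc matrix_mul_assoc)
  then show ?thesis by (simp only: inner_matrix_vector[of x "transpose B"] transpose_transpose)
qed

lemma psd_congruence:
  assumes "psd A"
  shows "psd (transpose B ** A ** B)"
proof -
  have "sym_mat (transpose B ** A ** B)"
    using psd_sym[OF assms] by (simp add: sym_mat_def matrix_algebra)
  then show ?thesis using psdD[OF assms] by (simp add: psd_def quadratic_congruence)
qed

lemma psd_mat1: "psd (mat 1)"
  unfolding psd_def by (auto simp only: matrix_vector_mul_lid inner_ge_zero intro: sym_mat_intros)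

lemma psd_gram: "psd (transpose B ** B)"
  using psd_congruence[OF psd_mat1, of B] by simp

text \<open>The form is nonnegative at sqrt(\<epsilon>) p + v / sqrt(\<epsilon>) and at the
  corresponding difference. The weight \<epsilon> stays free because the contraction estimate tunes
  it.\<close>

lemma psd_cauchy_schwarz_eps:
  assumes "psd P" "\<epsilon> > 0"
  shows "2 * \<bar>p \<bullet> (P *v v)\<bar> \<le> \<epsilon> * (p \<bullet> (P *v p)) + (v \<bullet> (P *v v)) / \<epsilon>"
proof -
  define s where "s = sqrt \<epsilon>"
  have s: "s > 0" "s * s = \<epsilon>" using assms(2) by (auto simp: s_def)
  have eq: "p \<bullet> (P *v v) = v \<bullet> (P *v p)"
    using inner_sym_mat[OF psd_sym[OF assms(1)], of p v] by (simp add: inner_commute)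
  have "0 \<le> (s *\<^sub>R p + (1/s) *\<^sub>R v) \<bullet> (P *v (s *\<^sub>R p + (1/s) *\<^sub>R v))"
       "0 \<le> (s *\<^sub>R p - (1/s) *\<^sub>R v) \<bullet> (P *v (s *\<^sub>R p - (1/s) *\<^sub>R v))"
    using assms(1) by (auto simp: psd_def)
  then have "0 \<le> (s * s) * (p \<bullet> (P *v p)) + 2 * (p \<bullet> (P *v v)) + (v \<bullet> (P *v v)) / (s * s)"
            "0 \<le> (s * s) * (p \<bullet> (P *v p)) - 2 * (p \<bullet> (P *v v)) + (v \<bullet> (P *v v)) / (s * s)"
    using s by (auto simp: matrix_vector_algebra inner_add inner_diff eq algebra_simps)
  then show ?thesis using s by (auto simp: abs_if)
qed

text \<open>With p = P x, the weighted Cauchy-Schwarz inequality at \<epsilon> = 1/c loses its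
  x-term and gives 2 |p|^2 <= (p . P p) / c <= |p|^2, which forces p = 0.\<close>

lemma psd_kernel:
  assumes "psd P" "x \<bullet> (P *v x) = 0"
  shows "P *v x = 0"
proof -
  obtain c where c: "c > 0" "\<And>x. norm (P *v x) \<le> c * norm x"
    using norm_matrix_vector_bound by blast
  define p where "p = P *v x"
  have pp: "p \<bullet> (P *v p) \<le> c * (p \<bullet> p)"
  proof -
    have "p \<bullet> (P *v p) \<le> norm p * norm (P *v p)" by (rule norm_cauchy_schwarz)
    also have "\<dots> \<le> norm p * (c * norm p)" using c by (intro mult_left_mono) auto
    finally show ?thesis by (simp add: dot_square_norm power2_eq_square mult_ac)
  qed
  have "2 * \<bar>p \<bullet> p\<bar> \<le> (1/c) * (p \<bullet> (P *v p))"
    using psd_cauchy_schwarz_eps[OF assms(1), of "1/c" p x] c assms(2) by (simp add: p_def)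
  also have "\<dots> \<le> p \<bullet> p" using pp c by (simp add: field_simps)
  finally have "p \<bullet> p = 0" using inner_ge_zero[of p] by linarith
  then show ?thesis by (simp add: p_def)
qed

lemma pos_def_iff_psd_injective: "pos_def P \<longleftrightarrow> psd P \<and> (\<forall>x. P *v x = 0 \<longrightarrow> x = 0)"
  using psd_kernel pos_def_psd unfolding pos_def_def psd_def
  by (metis inner_zero_right less_eq_real_def less_irrefl)

lemma unit_sphere_nonempty: "sphere (0 :: real^'n) 1 \<noteq> {}"
  using vector_choose_size[of 1] by (metis mem_sphere_0 empty_iff zero_le_one)

text \<open>The quotient of the two forms attains its minimum \<open>t\<close> on the compact unit
  sphere, and homogeneity carries the bound to all vectors. For symmetric matrices \<open>t\<close>
  is the least generalised eigenvalue.\<close>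

lemma quadratic_form_min:
  fixes Z Y :: "real^'n^'n"
  assumes "\<And>x. x \<noteq> 0 \<Longrightarrow> x \<bullet> (Y *v x) > 0"
  obtains x t where "x \<noteq> 0" "x \<bullet> (Z *v x) = t * (x \<bullet> (Y *v x))"
    "\<And>y. t * (y \<bullet> (Y *v y)) \<le> y \<bullet> (Z *v y)"
proof -
  define r where "r x = (x \<bullet> (Z *v x)) / (x \<bullet> (Y *v x))" for x
  have pos: "x \<bullet> (Y *v x) > 0" if "x \<in> sphere 0 1" for x
    using that assms[of x] by (cases "x = 0") auto
  have "continuous_on (sphere 0 1) r"
    unfolding r_def using pos by (intro continuous_intros linear_continuous_on)
      (auto intro!: linear_conv_bounded_linear[THEN iffD1] dest: pos less_imp_neq)
  then obtain x where x: "x \<in> sphere 0 1" "\<And>y. y \<in> sphere 0 1 \<Longrightarrow> r x \<le> r y"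
    using continuous_attains_inf[of "sphere (0::real^'n) 1" r] unit_sphere_nonempty by auto
  have le: "r x * (y \<bullet> (Y *v y)) \<le> y \<bullet> (Z *v y)" for y
  proof (cases "y = 0")
    case False
    define u where "u = (1 / norm y) *\<^sub>R y"
    have u: "u \<in> sphere 0 1" "y = norm y *\<^sub>R u" using False by (auto simp: u_def)
    have "r x * (u \<bullet> (Y *v u)) \<le> u \<bullet> (Z *v u)"
      using x(2)[OF u(1)] pos[OF u(1)] by (simp add: r_def[of u] field_simps)
    then have "(norm y * norm y) * (r x * (u \<bullet> (Y *v u))) \<le> (norm y * norm y) * (u \<bullet> (Z *v u))"
      by (intro mult_left_mono) auto
    then show ?thesis
      by (subst (1 2 3 4) u(2)) (simp add: matrix_vector_algebra algebra_simps)
  qed auto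
  have "x \<noteq> 0" using x(1) by auto
  moreover have "x \<bullet> (Z *v x) = r x * (x \<bullet> (Y *v x))" using pos[OF x(1)] by (simp add: r_def)
  ultimately show ?thesis using le that by blast
qed

lemma pos_def_coercive:
  assumes "\<And>x. x \<noteq> 0 \<Longrightarrow> x \<bullet> (Z *v x) > 0"
  obtains c where "c > 0" "\<And>x. c * (norm x)\<^sup>2 \<le> x \<bullet> ((Z :: real^'n^'n) *v x)"
proof -
  have "x \<noteq> 0 \<Longrightarrow> x \<bullet> (mat 1 *v x) > 0" for x :: "real^'n" by simp
  then obtain x t where xt: "x \<noteq> 0" "x \<bullet> (Z *v x) = t * (x \<bullet> (mat 1 *v x))"
    "\<And>y. t * (y \<bullet> (mat 1 *v y)) \<le> y \<bullet> (Z *v y)"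
    using quadratic_form_min[of "mat 1" Z thesis] by blast
  have "t > 0" using xt(1,2) assms[OF xt(1)] by (simp add: zero_less_mult_iff)
       (metis inner_ge_zero linorder_not_less)
  then show ?thesis using that[of t] xt(3) by (simp add: dot_square_norm)
qed

lemma pos_def_inverse:
  assumes "pos_def (P :: real^'n^'n)"
  obtains Z where "P ** Z = mat 1" "Z ** P = mat 1" "pos_def Z" "Z = matrix_inv P"
proof -
  have sP: "transpose P = P" using assms by (simp add: pos_def_def sym_mat_def)
  have "\<exists>B. B ** P = mat 1"
    unfolding matrix_left_invertible_ker using assms pos_def_iff_psd_injective by blast
  then have "invertible P" using invertible_left_inverse by blast
  define Z where "Z = matrix_inv P"
  have Z: "P ** Z = mat 1" "Z ** P = mat 1"
    using \<open>invertible P\<close> by (auto simp: Z_def invertible_def matrix_inv_def intro: someI2_ex)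
  have "transpose Z = transpose Z ** (P ** Z)" by (simp add: Z)
  also have "\<dots> = transpose (P ** Z) ** Z" by (simp add: matrix_algebra sP)
  finally have sZ: "transpose Z = Z" by (simp add: Z matrix_algebra)
  have "pos_def Z"
    unfolding pos_def_def sym_mat_def
  proof (intro conjI allI impI)
    fix x :: "real^'n" assume "x \<noteq> 0"
    have "Z *v x \<noteq> 0" using \<open>x \<noteq> 0\<close> Z(1)
      by (metis matrix_vector_mul_assoc matrix_vector_mul_lid matrix_vector_mult_0_right)
    then have "(Z *v x) \<bullet> (P *v (Z *v x)) > 0" using assms by (auto simp: pos_def_def)
    then show "x \<bullet> (Z *v x) > 0" by (simp add: matrix_vector_mul_assoc Z inner_commute)
  qed (rule sZ)
  then show ?thesis using that Z Z_def by blast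
qed

lemma matrix_eqI_quadratic:
  assumes "sym_mat (Z :: real^'n^'n)" "\<And>x. x \<bullet> (Z *v x) = 0"
  shows "Z = 0"
proof -
  have "psd Z" using assms by (simp add: psd_def)
  then have "Z *v x = 0" for x using psd_kernel assms(2) by blast
  then show ?thesis by (metis matrix_eq matrix_vector_mult_0)
qed

lemma psd_antisym:
  assumes "psd (A - B)" "psd (B - A)"
  shows "A = (B :: real^'n^'n)"
proof -
  have "x \<bullet> ((A - B) *v x) = 0" for x
    using psdD[OF assms(1), of x] psdD[OF assms(2), of x]
    by (simp add: matrix_vector_algebra inner_diff_right)
  then show ?thesis using matrix_eqI_quadratic[OF psd_sym[OF assms(1)]] by simp
qed

lemma pos_def_add_psd: "pos_def A \<Longrightarrow> psd B \<Longrightarrow> pos_def (A + B)"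
  by (auto simp: pos_def_def psd_def matrix_vector_algebra inner_add_right add_pos_nonneg)

lemma pos_def_scaleR: "pos_def A \<Longrightarrow> c > 0 \<Longrightarrow> pos_def (c *\<^sub>R A)"
  by (auto simp: pos_def_def matrix_vector_algebra)

lemma pos_def_mat1: "pos_def (mat 1)"
  by (auto simp: pos_def_def)

lemma pos_def_nonzero:
  assumes "pos_def (P :: real^'n^'n)" shows "P \<noteq> 0"
proof -
  obtain x :: "real^'n" where "x \<in> sphere 0 1" using unit_sphere_nonempty by blast
  then have "x \<noteq> 0" by auto
  then have "x \<bullet> (P *v x) > 0" using assms by (simp add: pos_def_def)
  then show ?thesis by auto
qed

lemma psd_limit:
  assumes "(f \<longlongrightarrow> P) sequentially" "\<And>k. psd (f k)"
  shows "psd P"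
  unfolding psd_def sym_mat_def
proof (intro conjI allI)
  have "(\<lambda>k. transpose (f k)) \<longlonglongrightarrow> transpose P" by (intro tendsto_intros assms)
  moreover have "(\<lambda>k. transpose (f k)) = f"
    using assms(2) by (simp add: psd_def sym_mat_def)
  ultimately show "transpose P = P" using assms(1) LIMSEQ_unique by metis
  fix x
  have "(\<lambda>k. x \<bullet> (f k *v x)) \<longlonglongrightarrow> x \<bullet> (P *v x)" by (intro tendsto_intros assms)
  then show "0 \<le> x \<bullet> (P *v x)"
    using psdD[OF assms(2)] by (intro LIMSEQ_le_const) auto
qed

section \<open>Bounds by the trace\<close>

lemma psd_trace_nonneg: "psd P \<Longrightarrow> 0 \<le> trace P"
  using psdD[of P "axis i 1" for i] by (auto simp: trace_def entry_eq_form intro!: sum_nonneg)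

text \<open>Cauchy-Schwarz on two unit vectors gives 2 |P_ij| <= P_ii + P_jj, and each diagonal
  entry is at most the trace. This is the source of compactness and of all bounds in terms of
  h.\<close>

lemma psd_entry_le_trace:
  assumes "psd P" shows "\<bar>P $ i $ j\<bar> \<le> trace P"
proof -
  have d: "0 \<le> P $ k $ k" for k using psdD[OF assms, of "axis k 1"] by (simp add: entry_eq_form)
  have t: "P $ k $ k \<le> trace P" for k
    unfolding trace_def using d by (intro member_le_sum) auto
  show ?thesis
    using psd_cauchy_schwarz_eps[OF assms, of 1 "axis i 1" "axis j 1"] t[of i] t[of j]
    by (simp add: entry_eq_form)
qed

lemma psd_trace_zero:
  assumes "psd P" "trace P \<le> 0" shows "P = 0"
proof -
  have "P $ i $ j = 0" for i j using psd_entry_le_trace[OF assms(1), of i j] assms(2) by linarith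
  then show ?thesis by (simp add: vec_eq_iff)
qed

lemma psd_norm_le_trace:
  assumes "psd (P :: real^'n^'n)" "trace P \<le> h"
  shows "norm (P *v x) \<le> real (CARD('n) * CARD('n)) * h * norm x"
proof -
  have "\<bar>P $ i $ j\<bar> \<le> h" for i j using psd_entry_le_trace[OF assms(1), of i j] assms(2) by linarith
  then have "onorm ((*v) P) \<le> real CARD('n) * real CARD('n) * h" by (rule onorm_le_matrix_component)
  then have "onorm ((*v) P) * norm x \<le> real CARD('n) * real CARD('n) * h * norm x"
    by (rule mult_right_mono) simp
  moreover have "norm (P *v x) \<le> onorm ((*v) P) * norm x"
    by (rule onorm) simp
  ultimately show ?thesis by simp
qed

lemma neg_form_scaleR: "neg_form N \<Longrightarrow> t > 0 \<Longrightarrow> neg_form (t *\<^sub>R N)"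
  by (simp add: neg_form_def matrix_vector_algebra mult_pos_neg)

lemma neg_form_diff_psd: "neg_form N \<Longrightarrow> psd P \<Longrightarrow> neg_form (N - P)"
  by (auto simp: neg_form_def psd_def matrix_vector_algebra inner_diff_right
      intro: order.strict_trans2)

lemma neg_form_minus_mat1: "neg_form (- mat 1)"
  by (simp add: neg_form_def matrix_vector_uminus)

lemma neg_form_minus_pos_def: "pos_def Q \<Longrightarrow> neg_form (- Q)"
  by (simp add: neg_form_def pos_def_def matrix_vector_uminus)

lemma neg_form_le:
  assumes "neg_form N" shows "x \<bullet> (N *v x) \<le> 0"
  using assms by (cases "x = 0") (auto simp: neg_form_def less_imp_le)

text \<open>Coercivity of -N beats the linear bound on G as soon as |t| < c / g. This is the
  openness step of both continuation arguments.\<close>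

lemma neg_form_perturb:
  assumes "neg_form N"
  obtains e where "e > 0" "\<And>t. \<bar>t\<bar> < e \<Longrightarrow> neg_form (N + t *\<^sub>R (G :: real^'n^'n))"
proof -
  have "x \<noteq> 0 \<Longrightarrow> x \<bullet> ((-N) *v x) > 0" for x using assms by (simp add: neg_form_def matrix_vector_uminus)
  then obtain c where c: "c > 0" "\<And>x. c * (norm x)\<^sup>2 \<le> x \<bullet> ((-N) *v x)"
    using pos_def_coercive by blast
  obtain g where g: "g > 0" "\<And>x. norm (G *v x) \<le> g * norm x" using norm_matrix_vector_bound by blast
  have "neg_form (N + t *\<^sub>R G)" if "\<bar>t\<bar> < c / g" for t
    unfolding neg_form_def
  proof (intro allI impI)
    fix x :: "real^'n" assume "x \<noteq> 0"
    have "\<bar>x \<bullet> (G *v x)\<bar> \<le> norm x * (g * norm x)"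
      using Cauchy_Schwarz_ineq2[of x "G *v x"] g(2)[of x] by (meson mult_left_mono norm_ge_zero order_trans)
    then have "\<bar>t\<bar> * \<bar>x \<bullet> (G *v x)\<bar> \<le> \<bar>t\<bar> * (g * (norm x)\<^sup>2)"
      by (intro mult_left_mono) (auto simp: power2_eq_square mult_ac)
    moreover have "\<bar>t\<bar> * (g * (norm x)\<^sup>2) < c * (norm x)\<^sup>2"
      using that g(1) \<open>x \<noteq> 0\<close> by (simp add: field_simps)
    ultimately have "\<bar>t * (x \<bullet> (G *v x))\<bar> < c * (norm x)\<^sup>2" by (simp add: abs_mult)
    then show "x \<bullet> ((N + t *\<^sub>R G) *v x) < 0"
      using c(2)[of x] by (simp add: matrix_vector_algebra inner_add_right)
  qed
  then show ?thesis using that[of "c/g"] c g by auto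
qed

section \<open>The Lyapunov operator\<close>

definition lyap :: "real^'n^'n \<Rightarrow> real^'n^'n \<Rightarrow> real^'n^'n" where
  "lyap M X = transpose M ** X + X ** M"

text \<open>Stability as the existence of a certificate; it agrees with \<open>hurwitz\<close> by
  \<open>hurwitz_iff_lstab\<close>. Asking only \<open>psd\<close> makes certificates easy to
  exhibit, and \<open>lyap_posdef\<close> restores definiteness.\<close>

definition lstab :: "real^'n^'n \<Rightarrow> bool" where
  "lstab M \<longleftrightarrow> (\<exists>Y. psd Y \<and> neg_form (lyap M Y))"

lemma lstabI: "psd Y \<Longrightarrow> neg_form (lyap M Y) \<Longrightarrow> lstab M"
  by (auto simp: lstab_def)

lemma lyap_form:
  assumes "sym_mat X"
  shows "x \<bullet> (lyap M X *v x) = 2 * ((X *v x) \<bullet> (M *v x))"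
proof -
  have "x \<bullet> (transpose M *v (X *v x)) = (X *v x) \<bullet> (M *v x)"
    by (simp only: inner_matrix_vector[of x] transpose_transpose inner_commute)
  moreover have "x \<bullet> (X *v (M *v x)) = (X *v x) \<bullet> (M *v x)"
    by (rule inner_sym_mat[OF assms])
  ultimately show ?thesis by (simp only: lyap_def matrix_vector_algebra inner_add_right)
qed

lemma lyap_bilinear_form:
  "sym_mat X \<Longrightarrow> x \<bullet> (lyap M X *v y) = (M *v x) \<bullet> (X *v y) + (X *v x) \<bullet> (M *v y)"
  by (simp only: lyap_def matrix_vector_mult_add_rdistrib matrix_vector_mul_assoc[symmetric]
      inner_add_right inner_transpose_vector inner_sym_mat)

lemma lyap_sym: "sym_mat X \<Longrightarrow> sym_mat (lyap M X)"
  by (simp add: sym_mat_def lyap_def matrix_algebra add.commute)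

lemma lyap_linear: "linear (lyap M)"
  by (rule linearI) (simp_all add: lyap_def matrix_algebra scaleR_add_right)

lemma lyap_scaleR: "lyap M (c *\<^sub>R X) = c *\<^sub>R lyap M X"
  by (rule linear_cmul[OF lyap_linear])

lemma lyap_add: "lyap M (X + Z) = lyap M X + lyap M Z"
  by (rule linear_add[OF lyap_linear])

lemma lyap_diff: "lyap M (X - Z) = lyap M X - lyap M Z"
  by (rule linear_diff[OF lyap_linear])

lemma lyap_tendsto [tendsto_intros]:
  "(f \<longlongrightarrow> a) F \<Longrightarrow> (g \<longlongrightarrow> b) F \<Longrightarrow> ((\<lambda>x. lyap (f x) (g x)) \<longlongrightarrow> lyap a b) F"
  unfolding lyap_def by (intro tendsto_intros)

text \<open>By \<open>lyap_form\<close>, the form of \<open>lyap M Y\<close> vanishes at every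
  kernel vector of \<open>Y\<close>.\<close>

lemma lyap_posdef:
  assumes "psd Y" "neg_form (lyap M Y)"
  shows "pos_def Y"
  unfolding pos_def_iff_psd_injective
proof (intro conjI allI impI, fact)
  fix x assume "Y *v x = 0"
  then have "x \<bullet> (lyap M Y *v x) = 0" using lyap_form[OF psd_sym[OF assms(1)], of x M] by simp
  then show "x = 0" using assms(2) by (force simp: neg_form_def)
qed

text \<open>At the minimal generalised eigenvalue \<open>t\<close> of \<open>Z\<close> relative to \<open>Y\<close>, the form of
  \<open>lyap M (Z - t Y)\<close> vanishes at the eigenvector; for \<open>t < 0\<close> it would be negative.\<close>

lemma psd_if_lyap_nonpos:
  assumes "lstab M" "sym_mat Z" "\<And>x. x \<bullet> (lyap M Z *v x) \<le> 0"
  shows "psd Z"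
proof -
  obtain Y where Y: "psd Y" "neg_form (lyap M Y)" using assms(1) by (auto simp: lstab_def)
  have pY: "x \<noteq> 0 \<Longrightarrow> x \<bullet> (Y *v x) > 0" for x
    using lyap_posdef[OF Y] by (simp add: pos_def_def)
  obtain x t where xt: "x \<noteq> 0" "x \<bullet> (Z *v x) = t * (x \<bullet> (Y *v x))"
    "\<And>y. t * (y \<bullet> (Y *v y)) \<le> y \<bullet> (Z *v y)"
    using quadratic_form_min[of Y Z thesis] pY by blast
  have "t \<ge> 0"
  proof (rule ccontr)
    assume "\<not> t \<ge> 0"
    have "sym_mat (Z - t *\<^sub>R Y)" using assms(2) psd_sym[OF Y(1)] by (intro sym_mat_intros)
    then have "psd (Z - t *\<^sub>R Y)"
      using xt(3) by (simp add: psd_def matrix_vector_algebra inner_diff)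
    moreover have "x \<bullet> ((Z - t *\<^sub>R Y) *v x) = 0"
      using xt(2) by (simp add: matrix_vector_algebra inner_diff)
    ultimately have "(Z - t *\<^sub>R Y) *v x = 0" by (rule psd_kernel)
    then have "Z *v x = t *\<^sub>R (Y *v x)" by (simp add: matrix_vector_algebra)
    then have "x \<bullet> (lyap M Z *v x) = t * (x \<bullet> (lyap M Y *v x))"
      using assms(2) psd_sym[OF Y(1)] by (simp add: lyap_form)
    moreover have "t * (x \<bullet> (lyap M Y *v x)) > 0"
      using Y(2) xt(1) \<open>\<not> t \<ge> 0\<close> by (auto simp: neg_form_def mult_neg_neg)
    ultimately show False using assms(3)[of x] by simp
  qed
  then have "0 \<le> y \<bullet> (Z *v y)" for y
    using xt(3)[of y] psdD[OF Y(1), of y] by (meson mult_nonneg_nonneg order_trans)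
  then show ?thesis using assms(2) by (simp add: psd_def)
qed

text \<open>On symmetric matrices the operator is injective: if \<open>lyap M X = 0\<close>, both X
  and -X are semidefinite by sign reversal. It maps this finite-dimensional space to itself, so it
  is onto.\<close>

lemma lyap_solve:
  assumes "lstab M" "sym_mat N"
  obtains X where "sym_mat X" "lyap M X = N"
proof -
  let ?S = "{X :: real^'a^'a. sym_mat X}"
  have sub: "subspace ?S" by (auto simp: subspace_def)
  have inj: "inj_on (lyap M) (span ?S)"
  proof (subst linear_inj_on_iff_eq_0[OF lyap_linear], rule subspace_span, intro ballI impI)
    fix X assume "X \<in> span ?S" and X0: "lyap M X = 0"
    then have sX: "sym_mat X" using sub by (metis mem_Collect_eq span_eq_iff)
    have X0': "lyap M (- X) = 0" using X0 linear_neg[OF lyap_linear, of M X] by simp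
    have "psd X" by (rule psd_if_lyap_nonpos[OF assms(1) sX]) (simp add: X0)
    moreover have "psd (- X)"
      by (rule psd_if_lyap_nonpos[OF assms(1)]) (use sX in \<open>auto simp: X0'\<close>)
    ultimately show "X = 0" using psd_antisym[of X 0] by simp
  qed
  have "dim (lyap M ` ?S) = dim ?S"
    using dim_image_eq[OF lyap_linear inj] .
  moreover have "lyap M ` ?S \<subseteq> ?S" using lyap_sym by auto
  moreover have "subspace (lyap M ` ?S)"
    using linear_subspace_image[OF lyap_linear sub] .
  ultimately have "lyap M ` ?S = ?S"
    using subspace_dim_equal[of "lyap M ` ?S" ?S] sub by simp
  then show ?thesis using assms(2) that by (metis (no_types, lifting) imageE mem_Collect_eq)
qed

lemma lyap_solve_neg:
  assumes "lstab M" "sym_mat N" "neg_form N"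
  obtains X where "pos_def X" "lyap M X = N"
proof -
  obtain X where X: "sym_mat X" "lyap M X = N" using lyap_solve assms by blast
  then have "psd X" using neg_form_le[OF assms(3)] by (intro psd_if_lyap_nonpos[OF assms(1)]) auto
  then show ?thesis using X assms(3) lyap_posdef that by blast
qed

section \<open>Complexification\<close>

definition re_vec :: "complex^'n \<Rightarrow> real^'n" where "re_vec x = (\<chi> i. Re (x $ i))"
definition im_vec :: "complex^'n \<Rightarrow> real^'n" where "im_vec x = (\<chi> i. Im (x $ i))"

lemma re_im_eqI: "re_vec x = re_vec y \<Longrightarrow> im_vec x = im_vec y \<Longrightarrow> x = y"
  by (simp add: re_vec_def im_vec_def vec_eq_iff complex_eq_iff)

lemma re_im_simps:
  "re_vec (x + y) = re_vec x + re_vec y" "im_vec (x + y) = im_vec x + im_vec y"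
  "re_vec (x - y) = re_vec x - re_vec y" "im_vec (x - y) = im_vec x - im_vec y"
  "re_vec (- x) = - re_vec x" "im_vec (- x) = - im_vec x"
  "re_vec 0 = 0" "im_vec 0 = 0"
  "re_vec (c *\<^sub>R x) = c *\<^sub>R re_vec x" "im_vec (c *\<^sub>R x) = c *\<^sub>R im_vec x"
  "re_vec (z *s x) = Re z *\<^sub>R re_vec x - Im z *\<^sub>R im_vec x"
  "im_vec (z *s x) = Re z *\<^sub>R im_vec x + Im z *\<^sub>R re_vec x"
  by (simp_all add: re_vec_def im_vec_def vec_eq_iff)

lemma re_vec_cmat: "re_vec (cmat M *v x) = M *v re_vec x"
  by (simp add: re_vec_def cmat_def vec_eq_iff matrix_vector_mult_def)

lemma im_vec_cmat: "im_vec (cmat M *v x) = M *v im_vec x"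
  by (simp add: im_vec_def cmat_def vec_eq_iff matrix_vector_mult_def)

lemmas re_im_cmat = re_im_simps re_vec_cmat im_vec_cmat

text \<open>The inner product on complex vectors is the real one, that is, the real part of the
  Hermitian product. Forms of \<open>cmat M\<close> therefore split into two forms of the real
  matrix \<open>M\<close>.\<close>

lemma inner_complex_vec: "x \<bullet> y = re_vec x \<bullet> re_vec y + im_vec x \<bullet> im_vec (y :: complex^'n)"
  by (simp add: inner_vec_def re_vec_def im_vec_def inner_complex_def sum.distrib)

lemma inner_cmat: "x \<bullet> (cmat M *v y) = (cmat (transpose M) *v x) \<bullet> y"
  by (simp only: inner_complex_vec re_im_cmat inner_matrix_vector)

lemma inner_cmat_self:
  "x \<bullet> (cmat M *v x) = re_vec x \<bullet> (M *v re_vec x) + im_vec x \<bullet> (M *v im_vec x)"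
  by (simp only: inner_complex_vec re_im_cmat)

lemma cmat_mult: "cmat (A ** B) *v x = cmat A *v (cmat B *v x)"
  by (intro re_im_eqI) (simp_all only: re_im_cmat matrix_vector_mul_assoc[symmetric])

lemma cmat_algebra:
  "cmat (A + B) *v x = cmat A *v x + cmat B *v x"
  "cmat (A - B) *v x = cmat A *v x - cmat B *v x"
  "cmat (- A) *v x = - (cmat A *v x)"
  "cmat (c *\<^sub>R A) *v x = c *\<^sub>R (cmat A *v x)"
  "cmat (mat 1) *v x = x"
  "cmat A *v (y + x) = cmat A *v y + cmat A *v x"
  "cmat A *v (y - x) = cmat A *v y - cmat A *v x"
  "cmat A *v (- x) = - (cmat A *v x)"
  "cmat A *v (z *s x) = z *s (cmat A *v x)"
  "cmat A *v (c *\<^sub>R x) = c *\<^sub>R (cmat A *v x)"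
  "cmat 0 *v x = 0"
  by (intro re_im_eqI;
      simp add: re_im_cmat matrix_vector_algebra scaleR_matrix_vector_assoc[symmetric]
        linear_neg[OF matrix_vector_mul_linear])+

lemma cmat_form_nonneg: "psd P \<Longrightarrow> 0 \<le> x \<bullet> (cmat P *v x)"
  by (simp add: inner_cmat_self psdD)

lemma cmat_form_kernel:
  assumes "psd P" "x \<bullet> (cmat P *v x) = 0" shows "cmat P *v x = 0"
proof -
  have "re_vec x \<bullet> (P *v re_vec x) = 0" "im_vec x \<bullet> (P *v im_vec x) = 0"
    using psdD[OF assms(1), of "re_vec x"] psdD[OF assms(1), of "im_vec x"] assms(2)
    by (auto simp: inner_cmat_self)
  then show ?thesis
    using psd_kernel[OF assms(1)] by (intro re_im_eqI) (simp_all add: re_im_cmat)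
qed

lemma cmat_pos_def_coercive:
  assumes "pos_def P"
  obtains c where "c > 0" "\<And>x. c * (norm x)\<^sup>2 \<le> x \<bullet> (cmat P *v x)"
proof -
  obtain c where c: "c > 0" "\<And>x. c * (norm x)\<^sup>2 \<le> x \<bullet> (P *v x)"
    using pos_def_coercive[of P thesis] assms by (auto simp: pos_def_def)
  have "c * (norm x)\<^sup>2 \<le> x \<bullet> (cmat P *v x)" for x
    using c(2)[of "re_vec x"] c(2)[of "im_vec x"]
    by (simp add: inner_cmat_self power2_norm_eq_inner inner_complex_vec[of x x] distrib_left)
  then show ?thesis using c that by blast
qed

lemma lyap_form_complex:
  "sym_mat X \<Longrightarrow> x \<bullet> (cmat (lyap M X) *v x) = 2 * ((cmat X *v x) \<bullet> (cmat M *v x))"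
  by (simp add: inner_cmat_self lyap_form) (simp add: inner_complex_vec re_im_cmat)

text \<open>For symmetric real X the Hermitian form at x is real, so only Re z survives. In
  particular, pairing X x with i\<omega>x gives 0, which is how every frequency-domain equation is
  exploited.\<close>

lemma inner_sym_cmat_scalar:
  assumes "sym_mat X"
  shows "(cmat X *v x) \<bullet> (z *s x) = Re z * ((cmat X *v x) \<bullet> x)"
  using inner_sym_mat[OF assms, of "re_vec x" "im_vec x"]
  by (simp add: inner_complex_vec re_im_cmat inner_diff inner_add algebra_simps)
     (simp add: inner_commute)

lemma inner_scalar_cnj: "x \<bullet> (z *s y) = (cnj z *s x) \<bullet> (y :: complex^'n)"
  by (simp add: inner_complex_vec re_im_simps inner_diff_left inner_diff_right inner_add_left inner_add_right algebra_simps)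

lemma norm_cmat_bound:
  obtains c where "c > 0" "\<And>x. norm (cmat M *v x) \<le> c * norm x"
proof -
  have "linear (\<lambda>x. cmat M *v x)"
    by (rule linearI) (simp_all add: cmat_algebra)
  then show ?thesis using linear_bounded_pos that by blast
qed

lemma mat_vector_mult: "mat z *v x = z *s (x :: complex^'n)"
  by (vector matrix_vector_mult_def mat_def) (simp add: if_distrib if_distribR cong: if_cong)

lemma det_eq_0_iff_eigenvector:
  fixes N :: "complex^'n^'n"
  shows "det (mat z - N) = 0 \<longleftrightarrow> (\<exists>x. x \<noteq> 0 \<and> N *v x = z *s x)"
proof -
  have *: "(mat z - N) *v x = z *s x - N *v x" for x :: "complex^'n"
    by (simp add: matrix_vector_mult_diff_rdistrib mat_vector_mult)
  have "det (mat z - N) \<noteq> 0 \<longleftrightarrow> (\<exists>B. B ** (mat z - N) = mat 1)"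
    by (simp only: invertible_det_nz[symmetric] invertible_left_inverse)
  also have "\<dots> \<longleftrightarrow> (\<forall>x. (mat z - N) *v x = 0 \<longrightarrow> x = 0)"
    by (rule matrix_left_invertible_ker)
  finally show ?thesis by (auto simp: *)
qed

lemma hurwitz_iff_eigenvector:
  "hurwitz M \<longleftrightarrow> (\<forall>z x. x \<noteq> 0 \<longrightarrow> cmat M *v x = z *s x \<longrightarrow> Re z < 0)"
  unfolding hurwitz_def det_eq_0_iff_eigenvector by blast

lemma eigenvector_transpose:
  assumes "x \<noteq> 0" "cmat (transpose M) *v x = z *s x"
  obtains y where "y \<noteq> 0" "cmat M *v y = z *s y"
proof -
  have "mat z - cmat (transpose M) = transpose (mat z - cmat M)"
    by (simp add: transpose_diff transpose_mat) (simp add: cmat_def transpose_def)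
  then have "det (mat z - cmat M) = 0"
    using det_eq_0_iff_eigenvector[of z "cmat (transpose M)"] assms by (auto simp: det_transpose)
  then show ?thesis using that det_eq_0_iff_eigenvector by blast
qed

subsection \<open>Eigenvectors in invariant sets\<close>

lemma vector_smult_eq_0: "a *s u = 0 \<longleftrightarrow> a = 0 \<or> u = (0 :: complex^'n)"
  by (simp add: vec.scale_eq_0_iff)

text \<open>Split off a root: if p = (X - \<mu>) q, either u is an eigenvector for \<mu>, or u' = N
  u - \<mu> u is a nonzero vector annihilated by q. Closure of V under every N - \<mu> keeps u' in
  V.\<close>

lemma eigenvector_from_annihilator:
  fixes N :: "complex^'n^'n"
  assumes V: "\<And>y \<mu>. y \<in> V \<Longrightarrow> N *v y - \<mu> *s y \<in> V"
  shows "u \<in> V \<Longrightarrow> u \<noteq> 0 \<Longrightarrow> p \<noteq> 0 \<Longrightarrow> degree p \<le> n \<Longrightarrow>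
    (\<Sum>i\<le>n. coeff p i *s (((*v) N) ^^ i) u) = 0 \<Longrightarrow>
    \<exists>y\<in>V. y \<noteq> 0 \<and> (\<exists>\<mu>. N *v y = \<mu> *s y)"
proof (induction n arbitrary: p u)
  case 0
  then have "coeff p 0 \<noteq> 0" by (metis le_zero_eq leading_coeff_0_iff)
  then show ?case using 0 by (simp add: vector_smult_eq_0)
next
  case (Suc n)
  show ?case
  proof (cases "degree p = 0")
    case True
    then have "coeff p 0 \<noteq> 0" using Suc.prems(3) by (metis leading_coeff_0_iff)
    moreover have "(\<Sum>i\<le>Suc n. coeff p i *s (((*v) N) ^^ i) u) = coeff p 0 *s u"
      using True by (subst sum.atMost_Suc_shift) (simp add: coeff_eq_0)
    ultimately show ?thesis using Suc.prems by (simp add: vector_smult_eq_0)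
  next
    case False
    then obtain \<mu> where "poly p \<mu> = 0"
      using fundamental_theorem_of_algebra[of p] constant_degree[of p] by auto
    then obtain q where q: "p = [:-\<mu>, 1:] * q" by (metis dvdE poly_eq_0_iff_dvd)
    then have "q \<noteq> 0" using Suc.prems(3) by auto
    have dq: "degree q \<le> n"
      using Suc.prems(4) \<open>q \<noteq> 0\<close> unfolding q by (subst (asm) degree_mult_eq) auto
    define u' where "u' = N *v u - \<mu> *s u"
    show ?thesis
    proof (cases "u' = 0")
      case True
      then show ?thesis using Suc.prems by (auto simp: u'_def)
    next
      case False
      let ?f = "\<lambda>i. (((*v) N) ^^ i) u"
      have c: "coeff p i = (case i of 0 \<Rightarrow> 0 | Suc j \<Rightarrow> coeff q j) - \<mu> * coeff q i" for i
        by (simp add: q coeff_pCons split: nat.split)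
      have pw: "(((*v) N) ^^ i) u' = ?f (Suc i) - \<mu> *s ?f i" for i
        by (induction i) (simp_all add: u'_def matrix_vector_mult_diff_distrib vec.linear_scale[OF matrix_vector_mul_linear_gen])
      have "(\<Sum>i\<le>Suc n. coeff p i *s ?f i)
          = (\<Sum>i\<le>Suc n. (case i of 0 \<Rightarrow> 0 | Suc j \<Rightarrow> coeff q j) *s ?f i) - (\<Sum>i\<le>Suc n. (\<mu> * coeff q i) *s ?f i)"
        unfolding c sum_subtractf[symmetric] by (simp add: vec.scale_left_diff_distrib)
      also have "(\<Sum>i\<le>Suc n. (case i of 0 \<Rightarrow> 0 | Suc j \<Rightarrow> coeff q j) *s ?f i) = (\<Sum>i\<le>n. coeff q i *s ?f (Suc i))"
        by (subst sum.atMost_Suc_shift) simp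
      also have "(\<Sum>i\<le>Suc n. (\<mu> * coeff q i) *s ?f i) = (\<Sum>i\<le>n. (\<mu> * coeff q i) *s ?f i)"
        using dq by (simp add: coeff_eq_0)
      also have "(\<Sum>i\<le>n. coeff q i *s ?f (Suc i)) - (\<Sum>i\<le>n. (\<mu> * coeff q i) *s ?f i)
          = (\<Sum>i\<le>n. coeff q i *s (((*v) N) ^^ i) u')"
        unfolding pw sum_subtractf[symmetric]
        by (simp add: vec.scale_right_diff_distrib mult.commute)
      finally have "(\<Sum>i\<le>n. coeff q i *s (((*v) N) ^^ i) u') = 0" using Suc.prems(5) by simp
      moreover have "u' \<in> V" using V Suc.prems(1) by (simp add: u'_def)
      ultimately show ?thesis using Suc.IH False \<open>q \<noteq> 0\<close> dq by blast
    qed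
  qed
qed

text \<open>The d + 1 iterates of u, with d the real dimension, satisfy a nontrivial linear
  relation. Its real coefficients form an annihilating polynomial, whose roots are then taken over
  the complex numbers.\<close>

lemma eigenvector_in_invariant_set:
  fixes N :: "complex^'n^'n"
  assumes V: "\<And>y \<mu>. y \<in> V \<Longrightarrow> N *v y - \<mu> *s y \<in> V" and u: "u \<in> V" "u \<noteq> 0"
  obtains y \<mu> where "y \<in> V" "y \<noteq> 0" "N *v y = \<mu> *s y"
proof -
  let ?f = "\<lambda>i. (((*v) N) ^^ i) u"
  define d where "d = DIM(complex^'n)"
  obtain c :: "nat \<Rightarrow> real" and j where c: "j \<le> d" "c j \<noteq> 0" "(\<Sum>i\<le>d. c i *\<^sub>R ?f i) = 0"
  \<comment> \<open>If two iterates coincide, their set is too small for the dimension count, but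
    their difference already is a relation.\<close>
  proof (cases "inj_on ?f {..d}")
    case True
    then have "card (?f ` {..d}) = Suc d" by (simp add: card_image)
    then have "dependent (?f ` {..d})" by (intro dependent_biggerset) (simp add: d_def)
    then obtain b v where b: "v \<in> ?f ` {..d}" "b v \<noteq> 0" "(\<Sum>v\<in>?f ` {..d}. b v *\<^sub>R v) = 0"
      by (auto simp: real_vector.dependent_finite)
    then show ?thesis using True that[of _ "\<lambda>i. b (?f i)"] by (auto simp: sum.reindex)
  next
    case False
    then obtain i j where ij: "i \<le> d" "j \<le> d" "i \<noteq> j" "?f i = ?f j" by (auto simp: inj_on_def)
    let ?c = "\<lambda>k. (if k = i then 1 else 0) - (if k = j then 1 else 0 :: real)"
    have "(\<Sum>k\<le>d. ?c k *\<^sub>R ?f k) = (\<Sum>k\<le>d. if k = i then ?f k else 0) - (\<Sum>k\<le>d. if k = j then ?f k else 0)"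
      unfolding sum_subtractf[symmetric] by (intro sum.cong) auto
    also have "\<dots> = 0" using ij by simp
    finally show ?thesis using that[of i ?c] ij by simp
  qed
  define p where "p = (\<Sum>i\<le>d. monom (complex_of_real (c i)) i)"
  have cp: "coeff p i = (if i \<le> d then complex_of_real (c i) else 0)" for i
    by (simp add: p_def coeff_sum)
  have "p \<noteq> 0" using cp[of j] c by auto
  moreover have "degree p \<le> d" by (rule degree_le) (simp add: cp)
  moreover have "(\<Sum>i\<le>d. coeff p i *s ?f i) = (\<Sum>i\<le>d. c i *\<^sub>R ?f i)"
    by (intro sum.cong) (simp_all add: cp vec_eq_iff scaleR_conv_of_real[where 'a=complex])
  ultimately show ?thesis
    using eigenvector_from_annihilator[of V N u p d] V u c(3) that by auto
qed

text \<open>The equation reads M^T U = - U M, so the range of U is invariant under M^T and contains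
  an eigenvector U x, with eigenvalue \<mu>. Pairing with x gives Re \<mu> (x . U x) = 0, where x .
  U x is nonzero because U x is.\<close>

lemma lyap_zero_imaginary_eigenvalue:
  assumes U: "psd U" "U \<noteq> 0" "lyap M U = 0"
  obtains \<omega> x where "x \<noteq> 0" "cmat M *v x = (\<i> * complex_of_real \<omega>) *s x"
proof -
  have eq: "cmat (transpose M) *v (cmat U *v x) = - (cmat U *v (cmat M *v x))" for x
  proof -
    have "transpose M ** U = - (U ** M)" using U(3) by (simp add: lyap_def eq_neg_iff_add_eq_0)
    then show ?thesis by (simp add: cmat_mult[symmetric] cmat_algebra(3)[symmetric])
  qed
  define V where "V = range (\<lambda>x. cmat U *v x)"
  have V: "cmat (transpose M) *v y - \<mu> *s y \<in> V" if "y \<in> V" for y \<mu>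
  proof -
    obtain x where "y = cmat U *v x" using \<open>y \<in> V\<close> unfolding V_def by blast
    then have "cmat (transpose M) *v y - \<mu> *s y = cmat U *v (- (cmat M *v x) - \<mu> *s x)"
      by (simp add: eq cmat_algebra)
    then show ?thesis by (auto simp: V_def)
  qed
  obtain w :: "real^'a" where "U *v w \<noteq> 0" using U(2) by (metis matrix_eq matrix_vector_mult_0)
  define w' :: "complex^'a" where "w' = (\<chi> i. complex_of_real (w $ i))"
  have "re_vec w' = w" by (simp add: w'_def re_vec_def)
  then have "cmat U *v w' \<noteq> 0" using \<open>U *v w \<noteq> 0\<close> by (metis re_vec_cmat re_im_simps(7))
  then obtain y \<mu> where y: "y \<in> V" "y \<noteq> 0" "cmat (transpose M) *v y = \<mu> *s y"
    using eigenvector_in_invariant_set[of V "cmat (transpose M)" "cmat U *v w'"] V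
    by (auto simp: V_def)
  obtain x where x: "y = cmat U *v x" using y(1) unfolding V_def by blast
  have "2 * ((cmat U *v x) \<bullet> (cmat M *v x)) = 0"
    using lyap_form_complex[OF psd_sym[OF U(1)], of x M] U(3) by (simp add: cmat_algebra)
  then have "x \<bullet> (cmat (transpose M) *v y) = 0"
    using inner_cmat[of x "transpose M" y] by (simp add: x inner_commute)
  then have "x \<bullet> (\<mu> *s y) = 0" by (simp only: y(3))
  then have "(cmat U *v x) \<bullet> (cnj \<mu> *s x) = 0"
    using inner_scalar_cnj[of x \<mu> y] by (simp add: x inner_commute)
  then have "Re \<mu> * ((cmat U *v x) \<bullet> x) = 0"
    by (simp add: inner_sym_cmat_scalar[OF psd_sym[OF U(1)]])
  moreover have "(cmat U *v x) \<bullet> x \<noteq> 0"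
    using cmat_form_kernel[OF U(1), of x] y(2) x by (auto simp: inner_commute)
  ultimately have "Re \<mu> = 0" by simp
  then have "\<mu> = \<i> * complex_of_real (Im \<mu>)" by (simp add: complex_eq_iff)
  then show ?thesis using eigenvector_transpose[OF y(2,3)] that by metis
qed

text \<open>Pair i\<omega>x = M x + y with Y x, where \<open>lyap M Y = - mat 1\<close>. The left
  side vanishes and the M-term is -|x|^2 / 2, so twice a norm bound for Y works at all frequencies
  at once.\<close>

lemma lstab_resolvent_bound:
  assumes "lstab M"
  obtains \<kappa> where "\<kappa> > 0"
    "\<And>\<omega> x y. (\<i> * complex_of_real \<omega>) *s x = cmat M *v x + y \<Longrightarrow> norm x \<le> \<kappa> * norm y"
proof -
  obtain Y where Y: "pos_def Y" "lyap M Y = - mat 1"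
    using lyap_solve_neg[OF assms, of "- mat 1"] neg_form_minus_mat1 by blast
  have sY: "sym_mat Y" using Y by (simp add: pos_def_def)
  obtain c where c: "c > 0" "\<And>x. norm (cmat Y *v x) \<le> c * norm x" using norm_cmat_bound by blast
  have "norm x \<le> (2 * c) * norm y" if "(\<i> * complex_of_real \<omega>) *s x = cmat M *v x + y" for \<omega> x y
  proof (cases "x = 0")
    case False
    have "0 = (cmat Y *v x) \<bullet> ((\<i> * complex_of_real \<omega>) *s x)"
      by (simp add: inner_sym_cmat_scalar[OF sY])
    also have "\<dots> = (cmat Y *v x) \<bullet> (cmat M *v x) + (cmat Y *v x) \<bullet> y"
      by (simp add: that inner_add_right)
    also have "(cmat Y *v x) \<bullet> (cmat M *v x) = - (norm x)\<^sup>2 / 2"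
      using lyap_form_complex[OF sY, of x M] by (simp add: Y cmat_algebra power2_norm_eq_inner)
    finally have "(norm x)\<^sup>2 = 2 * ((cmat Y *v x) \<bullet> y)" by simp
    also have "\<dots> \<le> 2 * (norm (cmat Y *v x) * norm y)" using norm_cauchy_schwarz by auto
    also have "\<dots> \<le> 2 * ((c * norm x) * norm y)" using c by (intro mult_left_mono mult_right_mono) auto
    finally have "norm x * norm x \<le> norm x * (2 * c * norm y)" by (simp add: power2_eq_square mult_ac)
    then show ?thesis using False by simp
  qed (use c in auto)
  then show ?thesis using that[of "2*c"] c by auto
qed

text \<open>The pairing of \<open>lstab_resolvent_bound\<close>, now at an eigenvector: -|x|^2 = 2
  Re z (x . Y x).\<close>

lemma lstab_imp_hurwitz:
  assumes "lstab M" shows "hurwitz M"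
  unfolding hurwitz_iff_eigenvector
proof (intro allI impI)
  fix z x assume x: "x \<noteq> 0" "cmat M *v x = z *s x"
  obtain Y where Y: "pos_def Y" "lyap M Y = - mat 1"
    using lyap_solve_neg[OF assms, of "- mat 1"] neg_form_minus_mat1 by blast
  have sY: "sym_mat Y" using Y by (simp add: pos_def_def)
  have "- (norm x)\<^sup>2 = 2 * ((cmat Y *v x) \<bullet> (cmat M *v x))"
    using lyap_form_complex[OF sY, of x M] by (simp add: Y cmat_algebra power2_norm_eq_inner)
  also have "\<dots> = 2 * Re z * (x \<bullet> (cmat Y *v x))"
    using inner_sym_cmat_scalar[OF sY, of x z] by (simp add: x inner_commute)
  finally have "2 * Re z * (x \<bullet> (cmat Y *v x)) < 0" using x(1)
    by (metis neg_less_0_iff_less zero_less_norm_iff zero_less_power)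
  moreover have "0 \<le> x \<bullet> (cmat Y *v x)" using cmat_form_nonneg pos_def_psd Y by blast
  ultimately show "Re z < 0" by (meson mult_nonneg_nonneg not_less zero_le_mult_iff zero_le_numeral)
qed

section \<open>Hurwitz matrices\<close>

text \<open>The solutions of \<open>lyap (M k) Y = - mat 1\<close> are normalised; if they are unbounded, the
  limit \<open>U\<close> satisfies \<open>lyap L U = 0\<close>.\<close>

lemma lstab_limit:
  assumes lim: "M \<longlonglongrightarrow> L" and st: "\<And>k. lstab (M k)"
    and im: "\<And>\<omega> x. x \<noteq> 0 \<Longrightarrow> cmat L *v x \<noteq> (\<i> * complex_of_real \<omega>) *s x"
  shows "lstab L"
proof -
  have "\<exists>Y. pos_def Y \<and> lyap (M k) Y = - mat 1" for k
    using lyap_solve_neg[OF st, of "- mat 1" k] neg_form_minus_mat1 by blast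
  then obtain Y where Y: "\<And>k. pos_def (Y k)" "\<And>k. lyap (M k) (Y k) = - mat 1" by metis
  have nz: "Y k \<noteq> 0" for k using pos_def_nonzero[OF Y(1)] .
  define U where "U k = (1 / norm (Y k)) *\<^sub>R Y k" for k
  have U1: "U k \<in> sphere 0 1" for k using nz[of k] by (simp add: U_def)
  obtain V r where V: "V \<in> sphere 0 1" "strict_mono r" "(U \<circ> r) \<longlonglongrightarrow> V"
    using compact_sphere[of 0 1] U1 unfolding compact_def by metis
  have Ml: "(\<lambda>k. M (r k)) \<longlonglongrightarrow> L"
    using LIMSEQ_subseq_LIMSEQ[OF lim V(2)] by (simp add: o_def)
  define a where "a k = 1 / norm (Y (r k))" for k
  have lU: "lyap (M (r k)) (U (r k)) = - (a k *\<^sub>R mat 1)" for k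
    by (simp add: U_def lyap_scaleR Y a_def)
  have l1: "(\<lambda>k. lyap (M (r k)) (U (r k))) \<longlonglongrightarrow> lyap L V"
    using V(3) by (intro tendsto_intros Ml) (simp add: o_def)
  \<comment> \<open>One diagonal entry suffices to see that \<open>a\<close> converges, since
    \<open>lyap (M (r k)) (U (r k))\<close> is a multiple of the identity.\<close>
  fix i :: 'a
  define \<alpha> where "\<alpha> = - (lyap L V $ i $ i)"
  have "(\<lambda>k. - (lyap (M (r k)) (U (r k)) $ i $ i)) \<longlonglongrightarrow> \<alpha>"
    unfolding \<alpha>_def by (intro tendsto_intros l1)
  then have al: "a \<longlonglongrightarrow> \<alpha>" unfolding lU by (simp add: mat_def)
  then have "(\<lambda>k. - (a k *\<^sub>R mat 1)) \<longlonglongrightarrow> - (\<alpha> *\<^sub>R (mat 1 :: real^'a^'a))"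
    by (intro tendsto_intros)
  then have LV: "lyap L V = - (\<alpha> *\<^sub>R mat 1)" using l1 LIMSEQ_unique unfolding lU by blast
  have "\<alpha> \<ge> 0" using al by (rule LIMSEQ_le_const) (auto simp: a_def)
  have pV: "psd V"
    using V(3) by (rule psd_limit) (simp add: U_def psd_scaleR pos_def_psd Y)
  have "V \<noteq> 0" using V(1) by auto
  have "\<alpha> \<noteq> 0"
  proof
    assume "\<alpha> = 0"
    then have "lyap L V = 0" using LV by simp
    then show False using lyap_zero_imaginary_eigenvalue[OF pV \<open>V \<noteq> 0\<close>] im by metis
  qed
  then have "neg_form (lyap L V)"
    using \<open>\<alpha> \<ge> 0\<close> by (simp add: LV neg_form_def matrix_vector_uminus matrix_vector_algebra)
  then show ?thesis using pV lstabI by blast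
qed

text \<open>The good parameters form a compact set containing 0; by openness to the right its
  maximum cannot lie below 1.\<close>

lemma continuation_unit_interval:
  assumes "P (0::real)"
    and open_right: "\<And>s. 0 \<le> s \<Longrightarrow> s < 1 \<Longrightarrow> P s \<Longrightarrow> \<exists>e>0. \<forall>t. s < t \<and> t < s + e \<longrightarrow> P t"
    and closed: "\<And>\<sigma> s. (\<And>k. 0 \<le> \<sigma> k \<and> \<sigma> k \<le> 1 \<and> P (\<sigma> k)) \<Longrightarrow> \<sigma> \<longlonglongrightarrow> s \<Longrightarrow> 0 \<le> s \<Longrightarrow> s \<le> 1 \<Longrightarrow> P s"
  shows "P 1"
proof -
  define S where "S = {s \<in> {0..1}. P s}"
  have "closed S" unfolding closed_sequential_limits
  proof (intro allI impI)
    fix \<sigma> s assume "(\<forall>k. \<sigma> k \<in> S) \<and> \<sigma> \<longlonglongrightarrow> s"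
    then have h: "\<And>k. 0 \<le> \<sigma> k \<and> \<sigma> k \<le> 1 \<and> P (\<sigma> k)" "\<sigma> \<longlonglongrightarrow> s" by (auto simp: S_def)
    have "s \<in> {0..1}" using h closed_sequentially[of "{0..1::real}" \<sigma> s] by auto
    then show "s \<in> S" using closed[OF h] by (auto simp: S_def)
  qed
  moreover have "bounded S" by (rule bounded_subset[of "{0..1}"]) (auto simp: S_def)
  ultimately have "compact S" by (simp add: compact_eq_bounded_closed)
  moreover have "0 \<in> S" using assms(1) by (simp add: S_def)
  ultimately obtain s where s: "s \<in> S" "\<And>t. t \<in> S \<Longrightarrow> t \<le> s"
    using compact_attains_sup[of S] by auto
  have "s = 1"
  proof (rule ccontr)
    assume "s \<noteq> 1"
    then obtain e where e: "e > 0" "\<And>t. s < t \<and> t < s + e \<Longrightarrow> P t"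
      using open_right[of s] s(1) by (auto simp: S_def)
    define t where "t = min 1 (s + e/2)"
    have "s < t" "t < s + e" "t \<le> 1" using s(1) e(1) \<open>s \<noteq> 1\<close> by (auto simp: t_def S_def)
    then have "t \<in> S" using e(2) s(1) by (auto simp: S_def)
    then show False using s(2) \<open>s < t\<close> by force
  qed
  then show ?thesis using s(1) by (simp add: S_def)
qed

text \<open>Continuation along \<open>N s\<close>, which shifts the spectrum of M to the left by (1
  - s)(c + 1). At s = 0 the shift exceeds the bound c on M, so the identity is a certificate. An
  imaginary eigenvalue of \<open>N s\<close> would shift back to an eigenvalue of M with nonnegative
  real part.\<close>

lemma hurwitz_imp_lstab:
  assumes "hurwitz (M :: real^'n^'n)" shows "lstab M"
proof -
  obtain c where c: "c > 0" "\<And>x. norm (M *v x) \<le> c * norm x" using norm_matrix_vector_bound by blast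
  define N where "N s = M - ((1 - s) * (c + 1)) *\<^sub>R mat 1" for s
  have lN: "lyap (N t) X = lyap (N s) X + (t - s) *\<^sub>R ((c + 1) *\<^sub>R X + (c + 1) *\<^sub>R X)" for s t X
    by (simp add: lyap_def N_def matrix_algebra algebra_simps)
  have "lstab (N 1)"
  proof (rule continuation_unit_interval[where P = "\<lambda>s. lstab (N s)"])
    have "neg_form (lyap (N 0) (mat 1))" unfolding neg_form_def
    proof (intro allI impI)
      fix x :: "real^'n" assume "x \<noteq> 0"
      have "x \<bullet> (M *v x) \<le> norm x * norm (M *v x)" by (rule norm_cauchy_schwarz)
      also have "\<dots> \<le> norm x * (c * norm x)" using c by (intro mult_left_mono) auto
      finally have "x \<bullet> (M *v x) \<le> c * (x \<bullet> x)"
        by (simp add: power2_norm_eq_inner[symmetric] power2_eq_square mult_ac)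
      moreover have "x \<bullet> x > 0" using \<open>x \<noteq> 0\<close> by simp
      moreover have "x \<bullet> (lyap (N 0) (mat 1) *v x) = 2 * (x \<bullet> (M *v x)) - 2 * (c * (x \<bullet> x)) - 2 * (x \<bullet> x)"
        by (subst lyap_form) (auto simp: N_def matrix_vector_algebra inner_diff_right algebra_simps)
      ultimately show "x \<bullet> (lyap (N 0) (mat 1) *v x) < 0" by linarith
    qed
    then show "lstab (N 0)" using psd_mat1 lstabI by blast
  next
    fix s assume "lstab (N s)"
    then obtain Y where Y: "psd Y" "neg_form (lyap (N s) Y)" by (auto simp: lstab_def)
    obtain e where e: "e > 0" "\<And>t. \<bar>t\<bar> < e \<Longrightarrow> neg_form (lyap (N s) Y + t *\<^sub>R ((c + 1) *\<^sub>R Y + (c + 1) *\<^sub>R Y))"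
      using neg_form_perturb[OF Y(2)] by blast
    show "\<exists>e>0. \<forall>t. s < t \<and> t < s + e \<longrightarrow> lstab (N t)"
    proof (intro exI[of _ e] conjI allI impI, fact e(1))
      fix t assume "s < t \<and> t < s + e"
      then have "neg_form (lyap (N t) Y)" unfolding lN[of t Y s] by (intro e(2)) simp
      then show "lstab (N t)" using Y(1) lstabI by blast
    qed
  next
    fix \<sigma> s assume h: "\<And>k. 0 \<le> \<sigma> k \<and> \<sigma> k \<le> 1 \<and> lstab (N (\<sigma> k))" "\<sigma> \<longlonglongrightarrow> s" "s \<le> 1"
    show "lstab (N s)"
    proof (rule lstab_limit)
      show "(\<lambda>k. N (\<sigma> k)) \<longlonglongrightarrow> N s" unfolding N_def by (intro tendsto_intros h)
      show "lstab (N (\<sigma> k))" for k using h by blast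
      fix \<omega> and x :: "complex^'n" assume "x \<noteq> 0"
      show "cmat (N s) *v x \<noteq> (\<i> * complex_of_real \<omega>) *s x"
      proof
        assume *: "cmat (N s) *v x = (\<i> * complex_of_real \<omega>) *s x"
        define z where "z = \<i> * complex_of_real \<omega> + of_real ((1 - s) * (c + 1))"
        have "cmat M *v x = cmat (N s) *v x + ((1 - s) * (c + 1)) *\<^sub>R x"
          by (simp add: N_def cmat_algebra)
        also have "\<dots> = z *s x"
          unfolding * by (simp add: vec_eq_iff z_def scaleR_conv_of_real[where 'a=complex] distrib_right)
        finally have "Re z < 0" using assms \<open>x \<noteq> 0\<close> unfolding hurwitz_iff_eigenvector by blast
        moreover have "Re z = (1 - s) * (c + 1)" by (simp add: z_def)
        ultimately show False using h(3) c(1) by (simp add: mult_less_0_iff)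
      qed
    qed
  qed
  then show ?thesis by (simp add: N_def)
qed

lemma hurwitz_iff_lstab: "hurwitz M \<longleftrightarrow> lstab M"
  using hurwitz_imp_lstab lstab_imp_hurwitz by blast

lemma lstab_transpose:
  assumes "lstab M" shows "lstab (transpose M)"
  unfolding hurwitz_iff_lstab[symmetric] hurwitz_iff_eigenvector
proof (intro allI impI)
  fix z x assume "x \<noteq> 0" "cmat (transpose M) *v x = z *s x"
  then obtain y where "y \<noteq> 0" "cmat M *v y = z *s y" using eigenvector_transpose by blast
  then show "Re z < 0" using lstab_imp_hurwitz[OF assms] unfolding hurwitz_iff_eigenvector by blast
qed

section \<open>Riccati equations\<close>

text \<open>The sign of \<open>W\<close> is left open: it is semidefinite for a fixed policy and
  indefinite for the game equation.\<close>

definition ric :: "real^'n^'n \<Rightarrow> real^'n^'n \<Rightarrow> real^'n^'n \<Rightarrow> real^'n^'n \<Rightarrow> real^'n^'n" where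
  "ric A Q W X = lyap A X + Q + X ** W ** X"

definition ric_sol :: "real^'n^'n \<Rightarrow> real^'n^'n \<Rightarrow> real^'n^'n \<Rightarrow> real^'n^'n \<Rightarrow> bool" where
  "ric_sol A Q W P \<longleftrightarrow> psd P \<and> ric A Q W P = 0 \<and> lstab (A + W ** P)"

text \<open>An exact second-order expansion. The derivative of the Riccati map at P is the Lyapunov
  operator of the closed loop \<open>A + W ** P\<close>, which links Riccati comparison to sign
  reversal.\<close>

lemma ric_taylor:
  assumes "sym_mat W" "sym_mat P" "sym_mat Z"
  shows "ric A Q W (P + Z) = ric A Q W P + lyap (A + W ** P) Z + Z ** W ** Z"
  using assms by (simp add: ric_def lyap_def sym_mat_def matrix_algebra algebra_simps)

lemma ric_sym: "sym_mat W \<Longrightarrow> sym_mat Q \<Longrightarrow> sym_mat P \<Longrightarrow> sym_mat (ric A Q W P)"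
  unfolding ric_def by (intro sym_mat_intros lyap_sym) (auto simp: sym_mat_def matrix_algebra)

lemma quadratic_sym_congruence:
  "sym_mat X \<Longrightarrow> x \<bullet> ((X ** W ** X) *v x) = (X *v x) \<bullet> (W *v (X *v x))"
  using quadratic_congruence[of x X W] by (simp add: sym_mat_def)

lemma psd_sym_congruence: "sym_mat X \<Longrightarrow> psd W \<Longrightarrow> psd (X ** W ** X)"
  using psd_congruence[of W X] by (simp add: sym_mat_def)

lemma sandwich_bilinear_form:
  "sym_mat X \<Longrightarrow> x \<bullet> ((X ** W ** X) *v y) = (X *v x) \<bullet> (W *v (X *v y))"
  by (simp only: matrix_vector_mul_assoc[symmetric] inner_sym_mat)

lemma ric_bilinear_form:
  "sym_mat X \<Longrightarrow> x \<bullet> (ric A Q W X *v y) =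
     (A *v x) \<bullet> (X *v y) + (X *v x) \<bullet> (A *v y) + x \<bullet> (Q *v y) + (X *v x) \<bullet> (W *v (X *v y))"
  by (simp only: ric_def matrix_vector_mult_add_rdistrib inner_add_right lyap_bilinear_form
      sandwich_bilinear_form)

text \<open>In the expansion around P the quadratic remainder is semidefinite, so the Lyapunov image
  of X - P is at most \<open>ric A Q W X\<close>.\<close>

lemma ric_sol_le:
  assumes P: "ric_sol A Q W P" and W: "psd W" and X: "sym_mat X"
    and le: "\<And>x. x \<bullet> (ric A Q W X *v x) \<le> 0"
  shows "psd (X - P)"
proof -
  have P': "psd P" "ric A Q W P = 0" "lstab (A + W ** P)" using P by (auto simp: ric_sol_def)
  have s: "sym_mat (X - P)" using X psd_sym[OF P'(1)] by blast
  have "ric A Q W X = lyap (A + W ** P) (X - P) + (X - P) ** W ** (X - P)"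
    using ric_taylor[OF psd_sym[OF W] psd_sym[OF P'(1)] s] by (simp add: P'(2))
  then have "x \<bullet> (lyap (A + W ** P) (X - P) *v x) \<le> 0" for x
    using le[of x] psdD[OF psd_sym_congruence[OF s W], of x]
    by (simp only: matrix_vector_algebra inner_add_right)
  then show ?thesis using psd_if_lyap_nonpos[OF P'(3) s] by blast
qed

lemma ric_sol_unique:
  assumes "ric_sol A Q W P" "ric_sol A Q W P'" "psd W" shows "P = P'"
  using ric_sol_le[OF assms(1) assms(3), of P'] ric_sol_le[OF assms(2) assms(3), of P] assms(1,2) psd_antisym
  by (auto simp: ric_sol_def psd_sym)

lemma ric_tendsto [tendsto_intros]:
  "(f \<longlongrightarrow> a) F \<Longrightarrow> (g \<longlongrightarrow> w) F \<Longrightarrow> (h \<longlongrightarrow> x) F \<Longrightarrow>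
   ((\<lambda>x. ric (f x) Q (g x) (h x)) \<longlongrightarrow> ric a Q w x) F"
  unfolding ric_def by (intro tendsto_intros)

text \<open>The Riccati map is convex, so the Newton step \<open>D\<close> at a subsolution \<open>P\<close> below \<open>X\<close> gives
  a larger subsolution below \<open>X\<close>; a subsolution of maximal trace is therefore a solution.\<close>

lemma ric_strict_imp_sol:
  assumes W: "psd W" and Q: "psd Q" and X: "psd X" and neg: "neg_form (ric A Q W X)"
  obtains P where "ric_sol A Q W P"
proof -
  define S where "S = {P. psd P \<and> psd (X - P) \<and> psd (ric A Q W P)}"
  have "closed S" unfolding closed_sequential_limits
  proof (intro allI impI)
    fix f P assume f: "(\<forall>k. f k \<in> S) \<and> f \<longlonglongrightarrow> P"
    then have lim: "f \<longlonglongrightarrow> P" by blast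
    have "psd P" using lim by (rule psd_limit) (use f in \<open>auto simp: S_def\<close>)
    moreover have "(\<lambda>k. X - f k) \<longlonglongrightarrow> X - P" by (intro tendsto_intros lim)
    then have "psd (X - P)" by (rule psd_limit) (use f in \<open>auto simp: S_def\<close>)
    moreover have "(\<lambda>k. ric A Q W (f k)) \<longlonglongrightarrow> ric A Q W P" by (intro tendsto_intros lim)
    then have "psd (ric A Q W P)" by (rule psd_limit) (use f in \<open>auto simp: S_def\<close>)
    ultimately show "P \<in> S" by (simp add: S_def)
  qed
  moreover have "bounded S"
  proof (rule boundedI)
    fix P assume "P \<in> S"
    then have P: "psd P" "psd (X - P)" by (auto simp: S_def)
    have "trace P \<le> trace X" using psd_trace_nonneg[OF P(2)] by (simp add: trace_sub)
    then have "\<bar>P $ i $ j\<bar> \<le> trace X" for i j using psd_entry_le_trace[OF P(1), of i j] by linarith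
    then show "norm P \<le> real CARD('a) * (real CARD('a) * trace X)" by (rule matrix_norm_le_entries)
  qed
  ultimately have "compact S" by (simp add: compact_eq_bounded_closed)
  moreover have "0 \<in> S" using X Q by (simp add: S_def psd_0 ric_def lyap_def)
  moreover have "continuous_on S trace" unfolding continuous_on_def by (auto intro!: tendsto_intros)
  ultimately obtain P where P: "P \<in> S" and max: "\<And>P'. P' \<in> S \<Longrightarrow> trace P' \<le> trace P"
    using continuous_attains_sup[of S trace] by blast
  have P': "psd P" "psd (X - P)" "psd (ric A Q W P)" using P by (auto simp: S_def)
  define M where "M = A + W ** P"
  have lX: "lyap M (X - P) = ric A Q W X - ric A Q W P - (X - P) ** W ** (X - P)"
    using ric_taylor[OF psd_sym[OF W] psd_sym[OF P'(1)] psd_sym[OF P'(2)], of A Q] by (simp add: M_def)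
  have XWX: "psd ((X - P) ** W ** (X - P))" using psd_sym_congruence psd_sym P'(2) W by blast
  \<comment> \<open>The gap X - P itself certifies the stability of M; this is where strictness at X
    enters.\<close>
  have "neg_form (lyap M (X - P))" unfolding neg_form_def
  proof (intro allI impI)
    fix x :: "real^'a" assume "x \<noteq> 0"
    then have "x \<bullet> (ric A Q W X *v x) < 0" using neg by (simp add: neg_form_def)
    then show "x \<bullet> (lyap M (X - P) *v x) < 0"
      using psdD[OF XWX, of x] psdD[OF P'(3), of x]
      by (simp only: lX matrix_vector_algebra inner_diff_right)
  qed
  then have M: "lstab M" using P'(2) lstabI by blast
  obtain D where D: "sym_mat D" "lyap M D = - ric A Q W P"
    using lyap_solve[OF M, of "- ric A Q W P"] psd_sym[OF P'(3)] by blast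
  have "psd D" by (rule psd_if_lyap_nonpos[OF M D(1)]) (simp add: D matrix_vector_uminus psdD[OF P'(3)])
  have "psd (P + D)" using P'(1) \<open>psd D\<close> by (rule psd_add)
  moreover have "psd (X - (P + D))"
  proof (rule psd_if_lyap_nonpos[OF M])
    show "sym_mat (X - (P + D))" using X P'(1) D(1) psd_sym by blast
    have "lyap M (X - (P + D)) = ric A Q W X - (X - P) ** W ** (X - P)"
      using lyap_diff[of M "X - P" D] by (simp add: lX D(2) diff_diff_eq)
    then show "x \<bullet> (lyap M (X - (P + D)) *v x) \<le> 0" for x
      using psdD[OF XWX, of x] neg_form_le[OF neg, of x]
      by (simp only: matrix_vector_algebra inner_diff_right)
  qed
  moreover have "psd (ric A Q W (P + D))"
  proof -
    have "ric A Q W (P + D) = D ** W ** D"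
      using ric_taylor[OF psd_sym[OF W] psd_sym[OF P'(1)] D(1), of A Q] D(2) by (simp add: M_def)
    then show ?thesis using psd_sym_congruence D(1) W by simp
  qed
  ultimately have "trace (P + D) \<le> trace P" by (intro max) (simp add: S_def)
  then have "D = 0" using \<open>psd D\<close> by (intro psd_trace_zero) (auto simp: trace_add)
  then have "ric A Q W P = 0" using D(2) by (simp add: lyap_def)
  then show ?thesis using P'(1) M that by (simp add: ric_sol_def M_def)
qed

text \<open>Y is chosen so that the derivative at P in direction Y is minus the identity; small
  positive t then yields strict supersolutions.\<close>

lemma ric_sol_perturb:
  assumes P: "ric_sol A Q W P" and W: "sym_mat W"
  obtains Y where "pos_def Y"
    "\<And>t. ric A Q W (P + t *\<^sub>R Y) = t *\<^sub>R (- mat 1 + t *\<^sub>R (Y ** W ** Y))"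
proof -
  obtain Y where Y: "pos_def Y" "lyap (A + W ** P) Y = - mat 1"
    using lyap_solve_neg[of "A + W ** P" "- mat 1"] neg_form_minus_mat1 P by (auto simp: ric_sol_def)
  have sY: "sym_mat (t *\<^sub>R Y)" for t using Y by (auto simp: pos_def_def)
  have sP: "sym_mat P" using P by (simp add: ric_sol_def psd_sym)
  have "ric A Q W (P + t *\<^sub>R Y) = t *\<^sub>R (- mat 1 + t *\<^sub>R (Y ** W ** Y))" for t
    using P unfolding ric_taylor[OF W sP sY] lyap_scaleR Y(2)
    by (simp add: ric_sol_def matrix_algebra algebra_simps)
  then show ?thesis using Y that by blast
qed

lemma ric_sol_imp_strict:
  assumes P: "ric_sol A Q W P" and W: "sym_mat W"
  obtains X where "psd X" "neg_form (ric A Q W X)"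
proof -
  obtain Y where Y: "pos_def Y"
    "\<And>t. ric A Q W (P + t *\<^sub>R Y) = t *\<^sub>R (- mat 1 + t *\<^sub>R (Y ** W ** Y))"
    using ric_sol_perturb[OF assms] by blast
  obtain e where e: "e > 0" "\<And>t. \<bar>t\<bar> < e \<Longrightarrow> neg_form (- mat 1 + t *\<^sub>R (Y ** W ** Y))"
    using neg_form_perturb[OF neg_form_minus_mat1] by blast
  have "neg_form (ric A Q W (P + (e/2) *\<^sub>R Y))"
    unfolding Y(2) using e by (intro neg_form_scaleR) auto
  moreover have "psd (P + (e/2) *\<^sub>R Y)"
    using P psd_scaleR[OF pos_def_psd[OF Y(1)], of "e/2"] e(1) by (simp add: ric_sol_def psd_add)
  ultimately show ?thesis using that by blast
qed

text \<open>Continuation in the size \<open>s\<close> of the quadratic term; the definiteness of \<open>W\<close> bounds the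
  solutions.\<close>

lemma ric_sol_exists_continuation:
  fixes W Q A :: "real^'n^'n"
  assumes W: "pos_def W" and Q: "pos_def Q" and A: "lstab A"
    and im: "\<And>s P \<omega> x. 0 \<le> s \<Longrightarrow> s \<le> 1 \<Longrightarrow> psd P \<Longrightarrow> ric A Q (s *\<^sub>R W) P = 0 \<Longrightarrow> x \<noteq> 0 \<Longrightarrow>
      cmat (A + (s *\<^sub>R W) ** P) *v x \<noteq> (\<i> * complex_of_real \<omega>) *s x"
  shows "\<exists>P. ric_sol A Q W P"
proof -
  have sW: "sym_mat (s *\<^sub>R W)" for s using W by (auto simp: pos_def_def)
  have zero: "\<exists>P. ric_sol A Q (0 *\<^sub>R W) P"
  proof -
    obtain P where "pos_def P" "lyap A P = - Q"
      using lyap_solve_neg[OF A, of "- Q"] Q neg_form_minus_pos_def by (auto simp: pos_def_def)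
    then show ?thesis using A by (intro exI[of _ P]) (simp add: ric_sol_def ric_def pos_def_psd)
  qed
  have "\<exists>P. ric_sol A Q (1 *\<^sub>R W) P"
  proof (rule continuation_unit_interval[where P = "\<lambda>s. \<exists>P. ric_sol A Q (s *\<^sub>R W) P", OF zero])
    fix s :: real assume "0 \<le> s" "\<exists>P. ric_sol A Q (s *\<^sub>R W) P"
    then obtain P where "ric_sol A Q (s *\<^sub>R W) P" by blast
    then obtain X where X: "psd X" "neg_form (ric A Q (s *\<^sub>R W) X)"
      using ric_sol_imp_strict sW by blast
    \<comment> \<open>The strict supersolution X survives a small increase of s, and solvability is
      deduced from X afresh. No dependence of the solution on s has to be controlled.\<close>
    obtain e where e: "e > 0" "\<And>t. \<bar>t\<bar> < e \<Longrightarrow> neg_form (ric A Q (s *\<^sub>R W) X + t *\<^sub>R (X ** W ** X))"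
      using neg_form_perturb[OF X(2)] by blast
    show "\<exists>e>0. \<forall>t. s < t \<and> t < s + e \<longrightarrow> (\<exists>P. ric_sol A Q (t *\<^sub>R W) P)"
    proof (intro exI[of _ e] conjI allI impI, fact e(1))
      fix t assume t: "s < t \<and> t < s + e"
      have "ric A Q (t *\<^sub>R W) X = ric A Q (s *\<^sub>R W) X + (t - s) *\<^sub>R (X ** W ** X)"
        by (simp add: ric_def matrix_algebra algebra_simps)
      then have "neg_form (ric A Q (t *\<^sub>R W) X)" using e(2)[of "t - s"] t by simp
      moreover have "psd (t *\<^sub>R W)" using t \<open>0 \<le> s\<close> W by (intro psd_scaleR pos_def_psd) auto
      ultimately show "\<exists>P. ric_sol A Q (t *\<^sub>R W) P"
        using ric_strict_imp_sol X(1) Q pos_def_psd by metis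
    qed
  next
    fix \<sigma> and s :: real
    assume h: "\<And>k. 0 \<le> \<sigma> k \<and> \<sigma> k \<le> 1 \<and> (\<exists>P. ric_sol A Q (\<sigma> k *\<^sub>R W) P)"
      "\<sigma> \<longlonglongrightarrow> s" "0 \<le> s" "s \<le> 1"
    show "\<exists>P. ric_sol A Q (s *\<^sub>R W) P"
    proof (cases "s = 0")
      case True
      then show ?thesis using zero by simp
    next
      case False
      then have "eventually (\<lambda>k. s / 2 < \<sigma> k) sequentially"
        using h(2,3) by (intro order_tendstoD) auto
      then obtain N where N: "\<And>k. k \<ge> N \<Longrightarrow> s / 2 < \<sigma> k" by (auto simp: eventually_sequentially)
      define \<tau> where "\<tau> k = \<sigma> (k + N)" for k
      have \<tau>: "\<tau> \<longlonglongrightarrow> s" unfolding \<tau>_def using h(2) by (rule LIMSEQ_ignore_initial_segment)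
      have "\<forall>k. \<exists>P. ric_sol A Q (\<tau> k *\<^sub>R W) P" unfolding \<tau>_def using h(1) by blast
      then obtain P where P: "\<And>k. ric_sol A Q (\<tau> k *\<^sub>R W) (P k)"
        using choice[of "\<lambda>k P. ric_sol A Q (\<tau> k *\<^sub>R W) P"] by blast
      have P': "psd (P k)" "ric A Q (\<tau> k *\<^sub>R W) (P k) = 0" for k using P by (auto simp: ric_sol_def)
      obtain a where a: "a > 0" "\<And>x. norm (A *v x) \<le> a * norm x" using norm_matrix_vector_bound by blast
      obtain w where w: "w > 0" "\<And>x. w * (norm x)\<^sup>2 \<le> x \<bullet> (W *v x)"
        using pos_def_coercive[of W thesis] W by (auto simp: pos_def_def)
      \<comment> \<open>With p = P k v, the equation gives (s/2) w |p|^2 <= 2 a |p| |v|. The factor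
        s/2 bounds \<tau> from below, which is why s = 0 was treated apart and the sequence cut to a
        tail.\<close>
      define b where "b = 4 * a / (s * w)"
      have bnd: "norm (P k *v v) \<le> b * norm v" for k v
      proof (cases "P k *v v = 0")
        case True
        then show ?thesis using a(1) w(1) h(3) by (simp add: b_def)
      next
        case nz: False
        define p where "p = P k *v v"
        have "0 = v \<bullet> (ric A Q (\<tau> k *\<^sub>R W) (P k) *v v)" by (simp add: P')
        also have "\<dots> = 2 * (p \<bullet> (A *v v)) + v \<bullet> (Q *v v) + \<tau> k * (p \<bullet> (W *v p))"
          unfolding ric_def matrix_vector_mult_add_rdistrib inner_add_right
            lyap_form[OF psd_sym[OF P'(1)]] quadratic_sym_congruence[OF psd_sym[OF P'(1)]]
          by (simp add: p_def matrix_vector_algebra)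
        finally have "\<tau> k * (p \<bullet> (W *v p)) \<le> - (2 * (p \<bullet> (A *v v)))"
          using psdD[OF pos_def_psd[OF Q], of v] by linarith
        also have "\<dots> \<le> 2 * (norm p * norm (A *v v))" using Cauchy_Schwarz_ineq2[of p "A *v v"] by linarith
        also have "\<dots> \<le> 2 * (norm p * (a * norm v))" using a by (intro mult_left_mono) auto
        finally have u: "\<tau> k * (p \<bullet> (W *v p)) \<le> 2 * (norm p * (a * norm v))" .
        have "(s / 2) * (w * (norm p)\<^sup>2) \<le> \<tau> k * (p \<bullet> (W *v p))"
          using N[of "k + N"] w(1) h(3) by (intro mult_mono w(2)) (auto simp: \<tau>_def)
        with u have "norm p * (s * w * norm p) \<le> norm p * (4 * a * norm v)"
          by (simp add: power2_eq_square algebra_simps)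
        then have "s * w * norm p \<le> 4 * a * norm v" using nz by (simp add: p_def)
        then show ?thesis using False h(3) w(1) by (simp add: b_def p_def field_simps)
      qed
      have "\<bar>P k $ i $ j\<bar> \<le> b" for k i j
      proof -
        have "\<bar>P k $ i $ j\<bar> \<le> norm (P k *v axis j 1)"
          by (simp add: matrix_vector_mult_basis column_def)
             (metis component_le_norm_cart vec_lambda_beta)
        also have "\<dots> \<le> b" using bnd[of k "axis j 1"] by simp
        finally show ?thesis .
      qed
      then have "bounded (range P)"
        by (intro boundedI[where B = "real CARD('n) * (real CARD('n) * b)"]) (auto intro: matrix_norm_le_entries)
      then obtain L r where L: "strict_mono (r :: nat \<Rightarrow> nat)" "(P \<circ> r) \<longlonglongrightarrow> L"
        using bounded_imp_convergent_subsequence by blast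
      have Pr: "(\<lambda>k. P (r k)) \<longlonglongrightarrow> L" using L(2) by (simp add: o_def)
      have \<tau>r: "(\<lambda>k. \<tau> (r k)) \<longlonglongrightarrow> s" using LIMSEQ_subseq_LIMSEQ[OF \<tau> L(1)] by (simp add: o_def)
      have pL: "psd L" using Pr P'(1) by (rule psd_limit)
      have "(\<lambda>k. ric A Q (\<tau> (r k) *\<^sub>R W) (P (r k))) \<longlonglongrightarrow> ric A Q (s *\<^sub>R W) L"
        by (intro tendsto_intros Pr \<tau>r)
      then have ric0: "ric A Q (s *\<^sub>R W) L = 0" by (simp add: P' LIMSEQ_const_iff)
      have "lstab (A + (s *\<^sub>R W) ** L)"
      proof (rule lstab_limit)
        show "(\<lambda>k. A + (\<tau> (r k) *\<^sub>R W) ** P (r k)) \<longlonglongrightarrow> A + (s *\<^sub>R W) ** L"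
          by (intro tendsto_intros Pr \<tau>r)
        show "lstab (A + (\<tau> (r k) *\<^sub>R W) ** P (r k))" for k using P by (simp add: ric_sol_def)
        show "\<And>\<omega> x. x \<noteq> 0 \<Longrightarrow> cmat (A + (s *\<^sub>R W) ** L) *v x \<noteq> (\<i> * complex_of_real \<omega>) *s x"
          using im[OF h(3,4) pL ric0] .
      qed
      then show ?thesis using pL ric0 by (auto simp: ric_sol_def)
    qed
  qed
  then show ?thesis by simp
qed

section \<open>The bounded real lemma\<close>

text \<open>The equation reads \<open>lyap A P = - (Q + P ** W ** P)\<close> with a positive
  definite bracket, so P is a Lyapunov certificate for the open loop A.\<close>

lemma ric_sol_pos_def:
  assumes "ric_sol A Q W P" "pos_def Q" "psd W"
  shows "lstab A" "pos_def P"
proof -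
  have P: "psd P" "ric A Q W P = 0" using assms(1) by (auto simp: ric_sol_def)
  have "lyap A P + (Q + P ** W ** P) = 0" using P(2) by (simp add: ric_def add.assoc)
  then have "lyap A P = - (Q + P ** W ** P)" by (simp only: eq_neg_iff_add_eq_0)
  moreover have "pos_def (Q + P ** W ** P)"
    using assms P by (intro pos_def_add_psd psd_sym_congruence psd_sym)
  ultimately have "neg_form (lyap A P)" using neg_form_minus_pos_def by metis
  then show "lstab A" "pos_def P" using P lstabI lyap_posdef by blast+
qed

section \<open>Gain in the frequency domain\<close>

lemma resolvent_eq_solvable:
  assumes "lstab A"
  obtains R where "\<And>y. (\<i> * complex_of_real \<omega>) *s (R *v y) = cmat A *v (R *v y) + y"
    "R = matrix_inv (mat (\<i> * complex_of_real \<omega>) - cmat A)"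
    "\<And>x y. (\<i> * complex_of_real \<omega>) *s x = cmat A *v x + y \<Longrightarrow> x = R *v y"
proof -
  define N where "N = mat (\<i> * complex_of_real \<omega>) - cmat A"
  have Nx: "N *v x = (\<i> * complex_of_real \<omega>) *s x - cmat A *v x" for x
    by (simp add: N_def matrix_vector_mult_diff_rdistrib mat_vector_mult)
  have "det N \<noteq> 0" using lstab_imp_hurwitz[OF assms] unfolding hurwitz_def N_def by force
  then have "invertible N" by (simp add: invertible_det_nz)
  then have R: "N ** matrix_inv N = mat 1" "matrix_inv N ** N = mat 1"
    by (auto simp: invertible_def matrix_inv_def intro: someI2_ex)
  show ?thesis
  proof (rule that[of "matrix_inv N"])
    fix y
    have "N *v (matrix_inv N *v y) = y" by (simp add: matrix_vector_mul_assoc R)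
    then show "(\<i> * complex_of_real \<omega>) *s (matrix_inv N *v y) = cmat A *v (matrix_inv N *v y) + y"
      by (simp add: Nx algebra_simps)
  next
    fix x y assume "(\<i> * complex_of_real \<omega>) *s x = cmat A *v x + y"
    then have "y = N *v x" by (simp add: Nx)
    then show "x = matrix_inv N *v y" by (simp add: matrix_vector_mul_assoc R)
  qed (simp add: N_def)
qed

text \<open>The strict H-infinity bound, phrased through the equation (i\<omega> - A) x = D w so
  that it can be paired with Riccati solutions without inverting a matrix. A single g below \<gamma>
  serves all frequencies.\<close>

definition l2_gain_below :: "real^'n^'n \<Rightarrow> real^'q^'n \<Rightarrow> real^'n^'p \<Rightarrow> real \<Rightarrow> bool" where
  "l2_gain_below A D C \<gamma> \<longleftrightarrow> (\<exists>g. 0 \<le> g \<and> g < \<gamma> \<and> (\<forall>\<omega> x w.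
     (\<i> * complex_of_real \<omega>) *s x = cmat A *v x + cmat D *v w \<longrightarrow> norm (cmat C *v x) \<le> g * norm w))"

lemma inner_gram_cmat: "x \<bullet> (cmat (transpose B ** B) *v x) = (norm (cmat B *v x))\<^sup>2"
  using inner_cmat[of x "transpose B" "cmat B *v x"]
  by (simp add: cmat_mult power2_norm_eq_inner transpose_transpose)

lemma ric_form_complex:
  assumes "sym_mat P"
  shows "x \<bullet> (cmat (ric A (transpose C ** C) W P) *v x) =
    2 * ((cmat P *v x) \<bullet> (cmat A *v x)) + (norm (cmat C *v x))\<^sup>2 + (cmat P *v x) \<bullet> (cmat W *v (cmat P *v x))"
proof -
  have "x \<bullet> (cmat (P ** W ** P) *v x) = (cmat P *v x) \<bullet> (cmat W *v (cmat P *v x))"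
    using inner_cmat[of x P] assms by (simp add: cmat_mult sym_mat_def)
  then show ?thesis
    by (simp add: ric_def cmat_algebra inner_add_right lyap_form_complex[OF assms] inner_gram_cmat)
qed

text \<open>The two sides differ by d (a q - b r)^2. The inequality combines the gains of the two
  input channels into g^2 + b^2 d.\<close>

lemma cauchy_schwarz_weighted:
  fixes a b d r q :: real
  assumes "d \<ge> 0"
  shows "(a * r + b * d * q)\<^sup>2 \<le> (a\<^sup>2 + b\<^sup>2 * d) * (r\<^sup>2 + d * q\<^sup>2)"
proof -
  have "(a\<^sup>2 + b\<^sup>2 * d) * (r\<^sup>2 + d * q\<^sup>2) - (a * r + b * d * q)\<^sup>2 = d * (a * q - b * r)\<^sup>2"
    by (simp add: power2_eq_square algebra_simps)
  then show ?thesis using assms by (smt (verit) mult_nonneg_nonneg zero_le_power2)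
qed

text \<open>The input matrix \<open>D\<close> is first augmented to \<open>[D, \<surd>d I]\<close> with small \<open>d\<close>, which keeps the gain
  below \<open>\<gamma>\<close> and makes the quadratic coefficient definite; the solution for the augmented system
  satisfies the original Riccati inequality strictly.\<close>

lemma bounded_real:
  fixes A :: "real^'n^'n" and D :: "real^'q^'n" and C :: "real^'n^'p"
  assumes "lstab A" "pos_def (transpose C ** C)" "\<gamma> > 0" "l2_gain_below A D C \<gamma>"
  shows "\<exists>P. ric_sol A (transpose C ** C) (inverse (\<gamma>\<^sup>2) *\<^sub>R (D ** transpose D)) P"
proof -
  obtain g where g: "0 \<le> g" "g < \<gamma>" "\<And>\<omega> x w. (\<i> * complex_of_real \<omega>) *s x = cmat A *v x + cmat D *v w
      \<Longrightarrow> norm (cmat C *v x) \<le> g * norm w"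
    using assms(4) unfolding l2_gain_below_def by blast
  obtain \<kappa> where \<kappa>: "\<kappa> > 0"
    "\<And>\<omega> x y. (\<i> * complex_of_real \<omega>) *s x = cmat A *v x + y \<Longrightarrow> norm x \<le> \<kappa> * norm y"
    using lstab_resolvent_bound[OF assms(1)] by blast
  obtain k where k: "k > 0" "\<And>x. norm (cmat C *v x) \<le> k * norm x" using norm_cmat_bound[of C thesis] by blast
  \<comment> \<open>\<open>b\<close> bounds the gain from an additive disturbance to C x. With the
    \<open>d\<close> below, g^2 + b^2 d is the midpoint of g^2 and \<gamma>^2, so the augmented gain
    stays below \<gamma>.\<close>
  define b where "b = k * \<kappa>"
  define d where "d = (\<gamma>\<^sup>2 - g\<^sup>2) / (2 * b\<^sup>2)"
  have "b > 0" using k \<kappa> by (simp add: b_def)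
  have "g\<^sup>2 < \<gamma>\<^sup>2" using g by (simp add: power_strict_mono)
  then have "d > 0" using \<open>b > 0\<close> by (simp add: d_def)
  define \<rho> where "\<rho> = inverse (\<gamma>\<^sup>2) * (g\<^sup>2 + b\<^sup>2 * d)"
  have "b\<^sup>2 * d = (\<gamma>\<^sup>2 - g\<^sup>2) / 2" using \<open>b > 0\<close> by (simp add: d_def)
  then have "g\<^sup>2 + b\<^sup>2 * d < \<gamma>\<^sup>2" using \<open>g\<^sup>2 < \<gamma>\<^sup>2\<close> by (simp add: field_simps)
  then have \<rho>: "\<rho> < 1" using assms(3) by (simp add: \<rho>_def field_simps)
  define e where "e = inverse (\<gamma>\<^sup>2)"
  have "e > 0" using assms(3) by (simp add: e_def)
  define W where "W = e *\<^sub>R (D ** transpose D)"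
  define W' where "W' = e *\<^sub>R (D ** transpose D + d *\<^sub>R mat 1)"
  let ?Q = "transpose C ** C"
  have psdDD: "psd (D ** transpose D)" using psd_gram[of "transpose D"] by (simp add: transpose_transpose)
  have "psd W" unfolding W_def using psdDD \<open>e > 0\<close> by (simp add: psd_scaleR)
  have "pos_def (d *\<^sub>R mat 1 + D ** transpose D)"
    using psdDD \<open>d > 0\<close> by (intro pos_def_add_psd pos_def_scaleR pos_def_mat1)
  then have pW': "pos_def W'" unfolding W'_def using \<open>e > 0\<close> by (intro pos_def_scaleR) (simp_all add: add.commute)
  have W'v: "cmat W' *v p = e *\<^sub>R (cmat D *v (cmat (transpose D) *v p) + d *\<^sub>R p)" for p
    by (simp add: W'_def cmat_algebra cmat_mult)
  have W'p: "p \<bullet> (cmat W' *v p) = e * ((norm (cmat (transpose D) *v p))\<^sup>2 + d * (norm p)\<^sup>2)" for p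
    using inner_cmat[of p D "cmat (transpose D) *v p"]
    by (simp add: W'v inner_add_right power2_norm_eq_inner distrib_left)
  have "\<exists>P. ric_sol A ?Q W' P"
  proof (rule ric_sol_exists_continuation[OF pW' assms(2,1)])
    fix s P \<omega> and x :: "complex^'n"
    assume s: "0 \<le> s" "s \<le> 1" and P: "psd P" and ric0: "ric A ?Q (s *\<^sub>R W') P = 0" and "x \<noteq> 0"
    show "cmat (A + (s *\<^sub>R W') ** P) *v x \<noteq> (\<i> * complex_of_real \<omega>) *s x"
    proof
      assume eig: "cmat (A + (s *\<^sub>R W') ** P) *v x = (\<i> * complex_of_real \<omega>) *s x"
      define p where "p = cmat P *v x"
      define r where "r = norm (cmat (transpose D) *v p)"
      define q where "q = norm p"
      \<comment> \<open>The feedback term s W' p is read as an external input, w entering through D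
        and u through the added channel. The closed-loop eigenvector becomes a forced response of A,
        to which the gain bounds apply.\<close>
      define w where "w = (s * e) *\<^sub>R (cmat (transpose D) *v p)"
      define u where "u = (s * e * d) *\<^sub>R p"
      have eq: "(\<i> * complex_of_real \<omega>) *s x = cmat A *v x + s *\<^sub>R (cmat W' *v p)"
        unfolding eig[symmetric] by (simp add: p_def cmat_algebra cmat_mult)
      also have "s *\<^sub>R (cmat W' *v p) = cmat D *v w + u"
        by (simp add: W'v w_def u_def cmat_algebra scaleR_add_right mult.assoc)
      finally have eq': "(\<i> * complex_of_real \<omega>) *s x = cmat A *v x + (cmat D *v w + u)" .
      have "0 = p \<bullet> ((\<i> * complex_of_real \<omega>) *s x)"
        by (simp add: p_def inner_sym_cmat_scalar[OF psd_sym[OF P]])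
      then have "p \<bullet> (cmat A *v x) = - (s * (p \<bullet> (cmat W' *v p)))"
        unfolding eq by (simp add: inner_add_right)
      moreover have "0 = x \<bullet> (cmat (ric A ?Q (s *\<^sub>R W') P) *v x)" by (simp add: ric0 cmat_algebra)
      \<comment> \<open>Energy balance: pairing the eigenvector equation with p eliminates A x from
        the Riccati identity. The gain bound will give the same quantity at most s \<rho> < 1 times
        itself.\<close>
      ultimately have cx: "(norm (cmat C *v x))\<^sup>2 = s * e * (r\<^sup>2 + d * q\<^sup>2)"
        unfolding ric_form_complex[OF psd_sym[OF P]] p_def[symmetric]
        by (simp add: cmat_algebra W'p r_def q_def)
      obtain R where R: "\<And>y. (\<i> * complex_of_real \<omega>) *s (R *v y) = cmat A *v (R *v y) + y"
        using resolvent_eq_solvable[OF assms(1)] by metis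
      define x1 where "x1 = R *v (cmat D *v w)"
      have x1: "(\<i> * complex_of_real \<omega>) *s x1 = cmat A *v x1 + cmat D *v w" by (simp add: x1_def R)
      have "(\<i> * complex_of_real \<omega>) *s (x - x1) = cmat A *v (x - x1) + u"
        unfolding vector_ssub_ldistrib x1 eq' by (simp add: cmat_algebra)
      then have "norm (x - x1) \<le> \<kappa> * norm u" by (rule \<kappa>(2))
      then have "norm (cmat C *v (x - x1)) \<le> b * norm u"
        using k(2)[of "x - x1"] k(1) unfolding b_def
        by (smt (verit, ccfv_SIG) mult.assoc mult_left_mono)
      moreover have "norm (cmat C *v x1) \<le> g * norm w" using g(3)[OF x1] .
      moreover have "cmat C *v x = cmat C *v x1 + cmat C *v (x - x1)" by (simp add: cmat_algebra)
      ultimately have "norm (cmat C *v x) \<le> g * norm w + b * norm u"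
        by (smt (verit) norm_triangle_ineq)
      also have "\<dots> = (s * e) * (g * r + b * d * q)"
        using s(1) \<open>e > 0\<close> \<open>d > 0\<close> by (simp add: w_def u_def r_def q_def algebra_simps)
      finally have "(norm (cmat C *v x))\<^sup>2 \<le> ((s * e) * (g * r + b * d * q))\<^sup>2"
        by (intro power_mono) auto
      also have "\<dots> = (s * e)\<^sup>2 * (g * r + b * d * q)\<^sup>2" by (simp add: power_mult_distrib)
      also have "\<dots> \<le> (s * e)\<^sup>2 * ((g\<^sup>2 + b\<^sup>2 * d) * (r\<^sup>2 + d * q\<^sup>2))"
        using \<open>d > 0\<close> by (intro mult_left_mono cauchy_schwarz_weighted) auto
      also have "\<dots> = s * \<rho> * (norm (cmat C *v x))\<^sup>2"
        unfolding cx \<rho>_def e_def[symmetric] by (simp add: power2_eq_square mult_ac)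
      finally have "(1 - s * \<rho>) * (norm (cmat C *v x))\<^sup>2 \<le> 0" by (simp add: algebra_simps)
      moreover have "s * \<rho> < 1" using s \<rho>
        by (metis mult_left_le_one_le mult_less_cancel_right2 not_less order_le_less_trans linorder_le_cases mult_nonneg_nonpos less_le_trans zero_less_one)
      ultimately have "(norm (cmat C *v x))\<^sup>2 = 0"
        by (smt (verit) mult_pos_pos zero_le_power2)
      then have "x \<bullet> (cmat ?Q *v x) = 0" by (simp add: inner_gram_cmat)
      moreover obtain c where "c > 0" "c * (norm x)\<^sup>2 \<le> x \<bullet> (cmat ?Q *v x)"
        using cmat_pos_def_coercive[OF assms(2)] by metis
      ultimately have "(norm x)\<^sup>2 \<le> 0" by (simp add: mult_le_0_iff)
      then show False using \<open>x \<noteq> 0\<close> by simp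
    qed
  qed
  then obtain P where P: "ric_sol A ?Q W' P" by blast
  have pP: "pos_def P" by (rule ric_sol_pos_def(2)[OF P assms(2) pos_def_psd[OF pW']])
  \<comment> \<open>Removing the added channel leaves -e d P^2, strictly negative because P is
    invertible.\<close>
  have "ric A ?Q W P = ric A ?Q W' P - (e * d) *\<^sub>R (transpose P ** P)"
    using pP by (simp add: pos_def_def sym_mat_def ric_def W_def W'_def matrix_algebra algebra_simps)
  then have ricW: "ric A ?Q W P = - ((e * d) *\<^sub>R (transpose P ** P))" using P by (simp add: ric_sol_def)
  have "neg_form (ric A ?Q W P)" unfolding neg_form_def
  proof (intro allI impI)
    fix x :: "real^'n" assume "x \<noteq> 0"
    then have "P *v x \<noteq> 0" using pP pos_def_iff_psd_injective by blast
    then have "0 < (e * d) * ((P *v x) \<bullet> (P *v x))" using \<open>e > 0\<close> \<open>d > 0\<close> by simp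
    then show "x \<bullet> (ric A ?Q W P *v x) < 0"
      using quadratic_congruence[of x P "mat 1"]
      by (simp add: ricW matrix_vector_uminus matrix_vector_algebra(6) inner_minus_right)
  qed
  then show ?thesis
    using ric_strict_imp_sol[OF \<open>psd W\<close> pos_def_psd[OF assms(2)] pos_def_psd[OF pP]]
    unfolding W_def e_def by metis
qed

text \<open>Pairing (i\<omega> - A) x = D w with X x and completing a square in w gives |C x|^2 + c
  |x|^2 <= \<gamma>^2 |w|^2, where c comes from strictness. As |x| >= |C x| / k, the left side is at
  least m |C x|^2, so the gain is \<gamma> / sqrt m < \<gamma>.\<close>

lemma bounded_real_converse:
  fixes A :: "real^'n^'n" and D :: "real^'q^'n" and C :: "real^'n^'p"
  assumes "\<gamma> > 0" "psd X"
    and neg: "neg_form (ric A (transpose C ** C) (inverse (\<gamma>\<^sup>2) *\<^sub>R (D ** transpose D)) X)"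
  shows "lstab A" "l2_gain_below A D C \<gamma>"
proof -
  let ?Q = "transpose C ** C"
  define e where "e = inverse (\<gamma>\<^sup>2)"
  have "e > 0" using assms(1) by (simp add: e_def)
  define W where "W = e *\<^sub>R (D ** transpose D)"
  have psdDD: "psd (D ** transpose D)" using psd_gram[of "transpose D"] by (simp add: transpose_transpose)
  have "psd W" unfolding W_def using psdDD \<open>e > 0\<close> by (simp add: psd_scaleR)
  have sX: "sym_mat X" using assms(2) by (rule psd_sym)
  define N where "N = ric A ?Q W X"
  have N: "neg_form N" using neg by (simp add: N_def W_def e_def)
  have "neg_form (lyap A X)" unfolding neg_form_def
  proof (intro allI impI)
    fix x :: "real^'n" assume "x \<noteq> 0"
    have "psd (?Q + X ** W ** X)" using psd_sym_congruence[OF sX \<open>psd W\<close>] psd_gram psd_add by blast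
    then have "0 \<le> x \<bullet> ((?Q + X ** W ** X) *v x)" by (rule psdD)
    moreover have "lyap A X = N - (?Q + X ** W ** X)" by (simp add: N_def ric_def)
    then have "x \<bullet> (lyap A X *v x) = x \<bullet> (N *v x) - x \<bullet> ((?Q + X ** W ** X) *v x)"
      by (simp only: matrix_vector_mult_diff_rdistrib inner_diff_right)
    moreover have "x \<bullet> (N *v x) < 0" using N \<open>x \<noteq> 0\<close> by (simp add: neg_form_def)
    ultimately show "x \<bullet> (lyap A X *v x) < 0" by linarith
  qed
  then show "lstab A" using assms(2) lstabI by blast
  have "sym_mat N" unfolding N_def using sX psd_sym[OF \<open>psd W\<close>] psd_sym[OF psd_gram] by (intro ric_sym)
  then have "pos_def (- N)" using N by (auto simp: pos_def_def neg_form_def matrix_vector_uminus)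
  then obtain c where c: "c > 0" "\<And>x. c * (norm x)\<^sup>2 \<le> x \<bullet> (cmat (- N) *v x)"
    using cmat_pos_def_coercive by blast
  obtain k where k: "k > 0" "\<And>x. norm (cmat C *v x) \<le> k * norm x" using norm_cmat_bound[of C thesis] by blast
  define m where "m = 1 + c / k\<^sup>2"
  have "m > 1" using c k by (simp add: m_def)
  have "norm (cmat C *v x) \<le> (\<gamma> / sqrt m) * norm w"
    if eq: "(\<i> * complex_of_real \<omega>) *s x = cmat A *v x + cmat D *v w" for \<omega> x w
  proof -
    define p where "p = cmat X *v x"
    define v where "v = cmat (transpose D) *v p"
    have "0 = p \<bullet> ((\<i> * complex_of_real \<omega>) *s x)" by (simp add: p_def inner_sym_cmat_scalar[OF sX])
    also have "\<dots> = p \<bullet> (cmat A *v x) + v \<bullet> w"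
      unfolding eq v_def by (simp only: inner_add_right inner_cmat[of p D w])
    finally have 1: "p \<bullet> (cmat A *v x) = - (v \<bullet> w)" by simp
    have "p \<bullet> (cmat W *v p) = e * (v \<bullet> v)"
      using inner_cmat[of p D v] by (simp add: W_def cmat_algebra cmat_mult v_def)
    then have "x \<bullet> (cmat N *v x) = - 2 * (v \<bullet> w) + (norm (cmat C *v x))\<^sup>2 + e * (v \<bullet> v)"
      unfolding N_def ric_form_complex[OF sX] p_def[symmetric] 1 by simp
    then have "c * (norm x)\<^sup>2 + (norm (cmat C *v x))\<^sup>2 \<le> 2 * (v \<bullet> w) - e * (v \<bullet> v)"
      using c(2)[of x] by (simp add: cmat_algebra)
    also have "\<dots> \<le> \<gamma>\<^sup>2 * (norm w)\<^sup>2"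
    proof -
      have "0 \<le> (\<gamma> *\<^sub>R w - (1/\<gamma>) *\<^sub>R v) \<bullet> (\<gamma> *\<^sub>R w - (1/\<gamma>) *\<^sub>R v)" by (rule inner_ge_zero)
      also have "\<dots> = \<gamma>\<^sup>2 * (w \<bullet> w) - 2 * (v \<bullet> w) + e * (v \<bullet> v)"
        using assms(1) by (simp add: inner_diff inner_commute[of w v] e_def power2_eq_square field_simps)
      finally show ?thesis by (simp add: power2_norm_eq_inner)
    qed
    finally have 2: "c * (norm x)\<^sup>2 + (norm (cmat C *v x))\<^sup>2 \<le> \<gamma>\<^sup>2 * (norm w)\<^sup>2" .
    have "(norm (cmat C *v x))\<^sup>2 \<le> (k * norm x)\<^sup>2" using k(2)[of x] by (intro power_mono) auto
    then have "c / k\<^sup>2 * (norm (cmat C *v x))\<^sup>2 \<le> c / k\<^sup>2 * (k * norm x)\<^sup>2"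
      using c(1) by (intro mult_left_mono) auto
    also have "\<dots> = c * (norm x)\<^sup>2" using k(1) by (simp add: power_mult_distrib)
    finally have "m * (norm (cmat C *v x))\<^sup>2 \<le> \<gamma>\<^sup>2 * (norm w)\<^sup>2" using 2 by (simp add: m_def algebra_simps)
    then have "(norm (cmat C *v x))\<^sup>2 \<le> \<gamma>\<^sup>2 * (norm w)\<^sup>2 / m"
      using \<open>m > 1\<close> by (simp add: pos_le_divide_eq mult.commute)
    also have "\<dots> = ((\<gamma> / sqrt m) * norm w)\<^sup>2"
      using \<open>m > 1\<close> by (simp add: power_mult_distrib power_divide)
    finally have "(norm (cmat C *v x))\<^sup>2 \<le> ((\<gamma> / sqrt m) * norm w)\<^sup>2" .
    moreover have "0 \<le> (\<gamma> / sqrt m) * norm w" using assms(1) \<open>m > 1\<close> by simp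
    ultimately show ?thesis by (rule power2_le_imp_le)
  qed
  moreover have "\<gamma> / sqrt m < \<gamma>" using assms(1) \<open>m > 1\<close> by (simp add: divide_less_eq)
  ultimately show "l2_gain_below A D C \<gamma>"
    unfolding l2_gain_below_def using assms(1) \<open>m > 1\<close> by (intro exI[of _ "\<gamma> / sqrt m"]) auto
qed

section \<open>The H-infinity norm as a gain\<close>

lemma norm_le_sigma_max: "norm (G *v x) \<le> sigma_max G * norm (x :: complex^'c)"
proof (cases "x = 0")
  case False
  have "linear (\<lambda>x. G *v x)"
    by (rule linearI, rule matrix_vector_right_distrib)
       (simp add: matrix_vector_mult_def vec_eq_iff scaleR_sum_right)
  then obtain c where c: "c > 0" "\<And>x. norm (G *v x) \<le> c * norm x" using linear_bounded_pos by blast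
  define y where "y = (1 / norm x) *\<^sub>R x"
  have y: "norm y = 1" "x = norm x *\<^sub>R y" using False by (auto simp: y_def)
  have "bdd_above {norm (G *v x) | x. norm x = 1}" using c(2) by (intro bdd_aboveI[of _ c]) (auto, metis mult.right_neutral)
  then have "norm (G *v y) \<le> sigma_max G" unfolding sigma_max_def using y by (intro cSup_upper) auto
  moreover have "G *v x = norm x *\<^sub>R (G *v y)"
    using linear_cmul[OF \<open>linear (\<lambda>x. G *v x)\<close>, of "norm x" y] y(2) by simp
  ultimately show ?thesis
    using mult_right_mono[of "norm (G *v y)" "sigma_max G" "norm x"] by (simp add: mult.commute)
qed simp

lemma sigma_max_le:
  assumes "\<And>x. norm (G *v x) \<le> g * norm (x :: complex^'c)" shows "sigma_max G \<le> g"
  unfolding sigma_max_def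
proof (rule cSup_least)
  obtain x :: "complex^'c" where "norm x = 1" using vector_choose_size[of 1] by auto
  then show "{norm (G *v x) |x. norm x = 1} \<noteq> {}" by auto
qed (use assms in \<open>auto, metis mult.right_neutral\<close>)

text \<open>Stability makes the resolvent exist on the imaginary axis, so the state equation has the
  unique solution given by the transfer matrix. A number strictly between the supremum and \<gamma>
  provides the uniform g.\<close>

lemma Kset_iff:
  "K \<in> Kset A B C D E \<gamma> \<longleftrightarrow> lstab (A_K A B K) \<and> l2_gain_below (A_K A B K) D (C - E ** K) \<gamma>"
    (is "_ \<longleftrightarrow> ?st \<and> ?gain")
proof (cases ?st)
  case True
  let ?T = "T_zw A B C D E K" and ?z = "\<lambda>\<omega>. \<i> * complex_of_real \<omega>"
  let ?A = "A_K A B K" and ?C = "C - E ** K"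
  have T: "?T \<omega> *v w = cmat ?C *v (matrix_inv (mat (?z \<omega>) - cmat ?A) *v (cmat D *v w))" for \<omega> w
    by (simp only: T_zw_def matrix_vector_mul_assoc[symmetric])
  have "hinf_norm ?T < ereal \<gamma> \<longleftrightarrow> ?gain"
  proof
    assume "hinf_norm ?T < ereal \<gamma>"
    then obtain g where g: "hinf_norm ?T < ereal g" "g < \<gamma>" using ereal_dense2 by fastforce
    have s: "sigma_max (?T \<omega>) \<le> g" for \<omega>
    proof -
      have "ereal (sigma_max (?T \<omega>)) \<le> hinf_norm ?T" unfolding hinf_norm_def by (rule SUP_upper) simp
      then show ?thesis using g(1) by (metis ereal_less_eq(3) order_le_less_trans less_imp_le)
    qed
    obtain w0 :: "complex^'d" where "norm w0 = 1" using vector_choose_size[of 1] by auto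
    then have "0 \<le> g" using norm_le_sigma_max[of "?T 0" w0] s[of 0]
      by (metis mult.right_neutral norm_ge_zero order_trans)
    moreover have "norm (cmat ?C *v x) \<le> g * norm w" if "?z \<omega> *s x = cmat ?A *v x + cmat D *v w" for \<omega> x w
    proof -
      have "x = matrix_inv (mat (?z \<omega>) - cmat ?A) *v (cmat D *v w)"
        using resolvent_eq_solvable[OF True] that by metis
      then have "cmat ?C *v x = ?T \<omega> *v w" using T[of \<omega> w] by simp
      then have "norm (cmat ?C *v x) \<le> sigma_max (?T \<omega>) * norm w" using norm_le_sigma_max by metis
      also have "\<dots> \<le> g * norm w" using s by (intro mult_right_mono) auto
      finally show ?thesis .
    qed
    ultimately show ?gain unfolding l2_gain_below_def using g(2) by blast
  next
    assume ?gain
    then obtain g where g: "0 \<le> g" "g < \<gamma>" "\<And>\<omega> x w. ?z \<omega> *s x = cmat ?A *v x + cmat D *v w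
      \<Longrightarrow> norm (cmat ?C *v x) \<le> g * norm w"
      unfolding l2_gain_below_def by blast
    have "sigma_max (?T \<omega>) \<le> g" for \<omega>
    proof (rule sigma_max_le)
      fix w :: "complex^'d"
      obtain R where R: "\<And>y. ?z \<omega> *s (R *v y) = cmat ?A *v (R *v y) + y"
        "R = matrix_inv (mat (?z \<omega>) - cmat ?A)"
        using resolvent_eq_solvable[OF True] by metis
      show "norm (?T \<omega> *v w) \<le> g * norm w"
        unfolding T R(2)[symmetric] by (rule g(3)[of \<omega>]) (rule R(1))
    qed
    then have "hinf_norm ?T \<le> ereal g" unfolding hinf_norm_def by (intro SUP_least) simp
    then show "hinf_norm ?T < ereal \<gamma>" using g(2) by (meson ereal_less(3) less_ereal.simps(1) order_le_less_trans)
  qed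
  then show ?thesis using True by (simp add: Kset_def hurwitz_iff_lstab)
qed (simp add: Kset_def hurwitz_iff_lstab)

section \<open>Policy iteration for the game Riccati equation\<close>

text \<open>With \<open>Z = P\<^sup>-\<^sup>1\<close> and \<open>\<Theta> = P\<^sub>0 - P\<^sub>0 Z P\<^sub>0\<close>, the Lyapunov image of \<open>\<Theta>\<close> at the
  stable closed loop of \<open>P\<^sub>0\<close> is \<open>-(I - P\<^sub>0 Z) Q (I - Z P\<^sub>0) + P\<^sub>0 Z (ric P) Z P\<^sub>0\<close>: in terms of the
  inverses the indefinite Riccati equation becomes convex.\<close>

lemma ric_sol_minimal:
  assumes P0: "ric_sol A Q V P\<^sub>0" and V: "sym_mat V" and Q: "psd Q" and P: "pos_def P"
    and le: "\<And>x. x \<bullet> (ric A Q V P *v x) \<le> 0"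
  shows "psd (P - P\<^sub>0)"
proof -
  have P0': "psd P\<^sub>0" "ric A Q V P\<^sub>0 = 0" "lstab (A + V ** P\<^sub>0)" using P0 by (auto simp: ric_sol_def)
  have s0: "sym_mat P\<^sub>0" using P0'(1) by (rule psd_sym)
  have sP: "sym_mat P" using P by (simp add: pos_def_def)
  obtain Z where Z: "P ** Z = mat 1" "Z ** P = mat 1" "pos_def Z" using pos_def_inverse[OF P] by metis
  have sZ: "sym_mat Z" using Z(3) by (simp add: pos_def_def)
  have PZ: "P *v (Z *v y) = y" for y by (simp add: matrix_vector_mul_assoc Z(1))
  define T where "T = P\<^sub>0 - P\<^sub>0 ** Z ** P\<^sub>0"
  have sT: "sym_mat T" using s0 sZ by (simp add: T_def sym_mat_def matrix_algebra)
  have Tv: "T *v v = P\<^sub>0 *v v - P\<^sub>0 *v (Z *v (P\<^sub>0 *v v))" for v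
    by (simp only: T_def matrix_vector_mult_diff_rdistrib matrix_vector_mul_assoc[symmetric])
  have "psd T"
  proof (rule psd_if_lyap_nonpos[OF P0'(3) sT])
    fix v
    define y where "y = P\<^sub>0 *v v"
    define z where "z = Z *v y"
    define u where "u = P\<^sub>0 *v z"
    \<comment> \<open>\<open>f1\<close> and \<open>f1'\<close> are the equation of
      \<open>P\<^sub>0\<close> at (v, v) and (z, v); \<open>f2\<close> is the inequality for P at z,
      where P z = y. Together they bound the Lyapunov form by minus the Q-form of v - z.\<close>
    have f1: "2 * (y \<bullet> (A *v v)) + v \<bullet> (Q *v v) + y \<bullet> (V *v y) = 0"
      using ric_bilinear_form[OF s0, of v A Q V v] P0'(2) by (simp add: y_def inner_commute)
    have f1': "y \<bullet> (A *v z) + u \<bullet> (A *v v) + z \<bullet> (Q *v v) + u \<bullet> (V *v y) = 0"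
      using ric_bilinear_form[OF s0, of z A Q V v] P0'(2) by (simp add: y_def u_def inner_commute)
    have f2: "2 * (y \<bullet> (A *v z)) + z \<bullet> (Q *v z) + y \<bullet> (V *v y) \<le> 0"
      using ric_bilinear_form[OF sP, of z A Q V z] le[of z] by (simp add: z_def PZ inner_commute)
    have q: "0 \<le> v \<bullet> (Q *v v) - 2 * (z \<bullet> (Q *v v)) + z \<bullet> (Q *v z)"
      using psdD[OF Q, of "v - z"] inner_sym_mat[OF psd_sym[OF Q], of v z]
      by (simp add: matrix_vector_mult_diff_distrib inner_diff inner_commute)
    have "v \<bullet> (lyap (A + V ** P\<^sub>0) T *v v) = 2 * ((y - u) \<bullet> (A *v v + V *v y))"
      by (simp add: lyap_form[OF sT] Tv y_def z_def u_def matrix_vector_mult_add_rdistrib matrix_vector_mul_assoc[symmetric])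
    also have "\<dots> = 2 * (y \<bullet> (A *v v)) + 2 * (y \<bullet> (V *v y)) - 2 * (u \<bullet> (A *v v)) - 2 * (u \<bullet> (V *v y))"
      by (simp add: inner_add_right inner_diff_left algebra_simps)
    finally show "v \<bullet> (lyap (A + V ** P\<^sub>0) T *v v) \<le> 0" using f1 f1' f2 q by linarith
  qed
  show ?thesis unfolding psd_def
  proof (intro conjI allI)
    show "sym_mat (P - P\<^sub>0)" using sP s0 by blast
    fix v
    define y where "y = P\<^sub>0 *v v"
    have "0 \<le> v \<bullet> y - y \<bullet> (Z *v y)"
      using psdD[OF \<open>psd T\<close>, of v] inner_sym_mat[OF s0, of v "Z *v y"]
      by (simp add: Tv y_def inner_diff_right)
    \<comment> \<open>Adding this square to v . y >= y . Z y cancels the inverse Z and leaves v . P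
      v >= v . y.\<close>
    moreover have "0 \<le> (v - Z *v y) \<bullet> (P *v (v - Z *v y))" using psdD[OF pos_def_psd[OF P]] .
    then have "0 \<le> v \<bullet> (P *v v) - 2 * (v \<bullet> y) + y \<bullet> (Z *v y)"
      using inner_sym_mat[OF sP, of "Z *v y" v]
      by (simp add: matrix_vector_mult_diff_distrib inner_diff PZ inner_commute)
    ultimately show "0 \<le> v \<bullet> ((P - P\<^sub>0) *v v)"
      by (simp add: matrix_vector_mult_diff_rdistrib inner_diff_right y_def)
  qed
qed

section \<open>Policy evaluation and improvement\<close>

locale game_riccati =
  fixes A :: "real^'n^'n" and B :: "real^'m^'n" and Q :: "real^'n^'n" and R :: "real^'m^'m"
    and W :: "real^'n^'n"
  assumes Q: "pos_def Q" and R: "pos_def R" and W: "psd W"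
begin

definition S :: "real^'n^'n" where "S = B ** matrix_inv R ** transpose B"

definition fb :: "real^'n^'n \<Rightarrow> real^'n^'m" where "fb P = matrix_inv R ** transpose B ** P"

definition policy_ric :: "real^'n^'m \<Rightarrow> real^'n^'n \<Rightarrow> real^'n^'n" where
  "policy_ric K P = ric (A - B ** K) (Q + transpose K ** R ** K) W P"

definition policy_sol :: "real^'n^'m \<Rightarrow> real^'n^'n \<Rightarrow> bool" where
  "policy_sol K P \<longleftrightarrow> ric_sol (A - B ** K) (Q + transpose K ** R ** K) W P"

lemma R_inverse:
  "R ** matrix_inv R = mat 1" "matrix_inv R ** R = mat 1" "pos_def (matrix_inv R)"
  using pos_def_inverse[OF R] by metis+

lemma psd_S: "psd S"
  using psd_congruence[OF pos_def_psd[OF R_inverse(3)], of "transpose B"]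
  by (simp add: S_def transpose_transpose)

lemma sym_V: "sym_mat (W - S)"
  using W psd_S psd_sym by blast

lemma pos_def_policy_cost: "pos_def (Q + transpose K ** R ** K)"
  using Q R by (intro pos_def_add_psd psd_congruence pos_def_psd)

text \<open>K enters the policy map quadratically, with minimiser \<open>fb P\<close> and the game
  Riccati map as minimum. Every policy solution is thus a supersolution of the game
  equation.\<close>

lemma complete_square:
  assumes "sym_mat P"
  shows "policy_ric K P = ric A Q (W - S) P + transpose (K - fb P) ** R ** (K - fb P)"
proof -
  have 1: "R ** (matrix_inv R ** X) = X" "matrix_inv R ** (R ** X) = X" for X :: "real^'n^'m"
    by (simp_all add: matrix_mul_assoc R_inverse)
  have "transpose (matrix_inv R) = matrix_inv R" using R_inverse(3) by (simp add: pos_def_def sym_mat_def)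
  then show ?thesis using assms
    by (simp add: policy_ric_def ric_def lyap_def fb_def S_def sym_mat_def matrix_algebra 1 algebra_simps)
qed

lemma policy_sol_props:
  assumes "policy_sol K P"
  shows "pos_def P" "policy_ric K P = 0"
    "ric A Q (W - S) P = - (transpose (K - fb P) ** R ** (K - fb P))"
proof -
  show "pos_def P"
    using ric_sol_pos_def(2)[OF assms[unfolded policy_sol_def] pos_def_policy_cost W] .
  then have "sym_mat P" by (simp add: pos_def_def)
  show 0: "policy_ric K P = 0" using assms by (simp add: policy_sol_def policy_ric_def ric_sol_def)
  show "ric A Q (W - S) P = - (transpose (K - fb P) ** R ** (K - fb P))"
    using complete_square[OF \<open>sym_mat P\<close>, of K] unfolding 0 by (simp add: eq_neg_iff_add_eq_0)
qed

text \<open>P need not be a strict supersolution for the new policy, as nothing is gained when K =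
  \<open>fb P\<close>. Moving to P + t Y gains -t from the old equation, while the mismatch of
  \<open>fb P\<close> and \<open>fb X\<close> costs only order t^2.\<close>

lemma policy_improvement:
  assumes "policy_sol K P"
  obtains X where "psd X" "neg_form (policy_ric (fb P) X)"
proof -
  have P: "pos_def P" by (rule policy_sol_props[OF assms])
  obtain Y where Y: "pos_def Y"
    "\<And>t. policy_ric K (P + t *\<^sub>R Y) = t *\<^sub>R (- mat 1 + t *\<^sub>R (Y ** W ** Y))"
    using ric_sol_perturb[OF assms[unfolded policy_sol_def] psd_sym[OF W]]
    unfolding policy_ric_def by metis
  let ?G = "Y ** W ** Y + transpose (fb Y) ** R ** fb Y"
  obtain e where e: "e > 0" "\<And>t. \<bar>t\<bar> < e \<Longrightarrow> neg_form (- mat 1 + t *\<^sub>R ?G)"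
    using neg_form_perturb[OF neg_form_minus_mat1] by blast
  define t where "t = e / 2"
  have t: "0 < t" "\<bar>t\<bar> < e" using e by (auto simp: t_def)
  define X where "X = P + t *\<^sub>R Y"
  have X: "psd X" using P Y(1) t(1) by (simp add: X_def psd_add psd_scaleR pos_def_psd)
  have sq: "fb P - fb X = - (t *\<^sub>R fb Y)" by (simp add: X_def fb_def matrix_algebra)
  have "policy_ric (fb P) X = policy_ric K X - transpose (K - fb X) ** R ** (K - fb X)
      + transpose (fb P - fb X) ** R ** (fb P - fb X)"
    using complete_square[OF psd_sym[OF X]] by simp
  also have "\<dots> = t *\<^sub>R (- mat 1 + t *\<^sub>R ?G) - transpose (K - fb X) ** R ** (K - fb X)"
    unfolding sq using Y(2)[of t] unfolding X_def[symmetric]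
    by (simp add: matrix_algebra algebra_simps)
  finally have "policy_ric (fb P) X = \<dots>" .
  moreover have "neg_form \<dots>"
    using t e(2) R by (intro neg_form_diff_psd neg_form_scaleR psd_congruence pos_def_psd)
  ultimately show ?thesis using X that by simp
qed

text \<open>The estimate comes from the Lyapunov operator of the improved closed loop \<open>M\<close>, for which
  \<open>lyap M \<delta> = -Y - \<delta>W\<delta>\<close>. The image of \<open>\<Delta>\<close> is bounded below by \<open>-Y - \<Delta>S\<Delta> - \<delta>W\<delta>\<close>, and
  \<open>\<Phi> = \<Delta>X\<Delta>\<close>, where \<open>X\<close> solves the dual Lyapunov equation of the optimal loop, contributes
  \<open>\<Delta>\<^sup>2\<close> up to multiples of \<open>Y + \<delta>W\<delta>\<close>. Hence \<open>lyap M (\<Delta> + c\<^sub>2 \<Phi> - c\<^sub>3 \<delta>) \<ge> 0\<close>.\<close>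

lemma policy_iteration_contraction:
  assumes P0: "ric_sol A Q (W - S) P\<^sub>0" and h: "h > 0"
  obtains c where "c \<ge> 1"
    "\<And>K P P'. policy_sol K P \<Longrightarrow> policy_sol (fb P) P' \<Longrightarrow> trace (P - P\<^sub>0) \<le> h \<Longrightarrow>
       trace (P - P\<^sub>0) \<le> c * (trace (P - P\<^sub>0) - trace (P' - P\<^sub>0))"
proof -
  define M0 where "M0 = A + (W - S) ** P\<^sub>0"
  have P0': "psd P\<^sub>0" "ric A Q (W - S) P\<^sub>0 = 0" "lstab M0" using P0 by (auto simp: ric_sol_def M0_def)
  obtain X where X: "pos_def X" "lyap (transpose M0) X = - mat 1"
    using lyap_solve_neg[OF lstab_transpose[OF P0'(3)], of "- mat 1"] neg_form_minus_mat1 by blast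
  have sX: "sym_mat X" using X(1) by (simp add: pos_def_def)
  have Xa: "2 * ((M0 *v (X *v a)) \<bullet> a) = - (norm a)\<^sup>2" for a
    using lyap_form[OF sX, of a "transpose M0"]
    unfolding inner_transpose_vector X(2) by (simp add: matrix_vector_uminus power2_norm_eq_inner)
  obtain \<xi> where \<xi>: "\<xi> > 0" "\<And>x. norm (X *v x) \<le> \<xi> * norm x" using norm_matrix_vector_bound by blast
  obtain m where m: "m > 0" "\<And>x. norm (M0 *v x) \<le> m * norm x" using norm_matrix_vector_bound by blast
  obtain w where w: "w > 0" "\<And>x. norm (W *v x) \<le> w * norm x" using norm_matrix_vector_bound by blast
  obtain s where s: "s > 0" "\<And>x. norm (S *v x) \<le> s * norm x" using norm_matrix_vector_bound by blast
  define d where "d = real (CARD('n) * CARD('n)) * h"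
  have "d > 0" using h by (simp add: d_def)
  \<comment> \<open>A bound for the form of Y, which equals minus
    \<open>lyap M0 \<Delta> + \<Delta> ** (W - S) ** \<Delta>\<close>; here d bounds
    \<Delta>.\<close>
  define y where "y = 2 * d * m + d * (w + s) * d"
  have "y > 0" using \<open>d > 0\<close> m(1) w(1) s(1) by (simp add: y_def add_pos_pos)
  \<comment> \<open>\<open>c1\<close> is the weight on Y + \<delta>W\<delta> after the cross terms
    in the image of \<Phi> have used up half of |\<Delta>v|^2. \<open>c2\<close> scales the other
    half to s |\<Delta>v|^2, the loss due to S, and \<open>c3\<close> is the total weight on Y +
    \<delta>W\<delta>.\<close>
  define c1 where "c1 = 4 * y * \<xi>\<^sup>2 + 4 * w * d\<^sup>2 * \<xi>\<^sup>2"
  define c2 where "c2 = 2 * s"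
  define c3 where "c3 = 1 + c2 * c1"
  have "c1 > 0" using \<open>y > 0\<close> \<open>d > 0\<close> \<xi>(1) w(1) by (simp add: c1_def add_pos_pos)
  have "c2 > 0" using s(1) by (simp add: c2_def)
  have form_le: "u \<bullet> (N *v u) \<le> k * (norm u)\<^sup>2" if "\<And>x. norm (N *v x) \<le> k * norm x" for N :: "real^'n^'n" and k u
    using norm_cauchy_schwarz[of u "N *v u"] mult_left_mono[OF that[of u], of "norm u"]
    by (simp add: power2_eq_square mult_ac)
  show ?thesis
  proof (rule that[of c3])
    show "c3 \<ge> 1" using \<open>c1 > 0\<close> \<open>c2 > 0\<close> by (simp add: c3_def)
    fix K P P' assume KP: "policy_sol K P" and KP': "policy_sol (fb P) P'" and trh: "trace (P - P\<^sub>0) \<le> h"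
    define \<Delta> where "\<Delta> = P - P\<^sub>0"
    define \<delta> where "\<delta> = P - P'"
    define Y where "Y = transpose (K - fb P) ** R ** (K - fb P)"
    have Y: "psd Y" unfolding Y_def by (intro psd_congruence pos_def_psd R)
    have P: "pos_def P" "ric A Q (W - S) P = - Y" using policy_sol_props[OF KP] by (auto simp: Y_def)
    have P': "pos_def P'" "ric_sol (A - B ** fb P) (Q + transpose (fb P) ** R ** fb P) W P'"
      using policy_sol_props(1)[OF KP'] KP' by (auto simp: policy_sol_def)
    have \<Delta>: "psd \<Delta>" unfolding \<Delta>_def
      using ric_sol_minimal[OF P0 sym_V pos_def_psd[OF Q] P(1)] psdD[OF Y]
      by (simp add: P(2) matrix_vector_uminus)
    have s\<Delta>: "sym_mat \<Delta>" using \<Delta> by (rule psd_sym)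
    have s\<delta>: "sym_mat \<delta>" using P(1) P'(1) by (auto simp: \<delta>_def pos_def_def)
    have d: "norm (\<Delta> *v x) \<le> d * norm x" for x
      unfolding d_def using psd_norm_le_trace[OF \<Delta>, of h x] trh by (simp add: \<Delta>_def)
    define M where "M = (A - B ** fb P) + W ** P'"
    have lM: "lstab M" using P'(2) by (simp add: ric_sol_def M_def)
    \<comment> \<open>The control already responds to P, the disturbance only to P' = P - \<delta>;
      hence S acts on \<Delta> but W on \<Delta> - \<delta>.\<close>
    have M_eq: "M = M0 + (W - S) ** \<Delta> - W ** \<delta>"
      by (simp add: M_def M0_def \<Delta>_def \<delta>_def fb_def S_def matrix_algebra)
    have e1: "lyap M0 \<Delta> + \<Delta> ** (W - S) ** \<Delta> = - Y"
      using ric_taylor[OF sym_V psd_sym[OF P0'(1)] s\<Delta>, of A Q] P(2) P0'(2)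
      by (simp add: \<Delta>_def M0_def)
    have e2: "lyap M \<delta> + \<delta> ** W ** \<delta> = - Y"
    proof -
      have "policy_ric (fb P) P = - Y"
        using complete_square[of P "fb P"] P by (simp add: pos_def_def)
      moreover have "policy_ric (fb P) (P' + \<delta>) = lyap M \<delta> + \<delta> ** W ** \<delta>"
        unfolding policy_ric_def M_def
        using ric_taylor[OF psd_sym[OF W] _ s\<delta>, of P'] P' by (simp add: ric_sol_def pos_def_def)
      ultimately show ?thesis by (simp add: \<delta>_def)
    qed
    define \<Phi> where "\<Phi> = \<Delta> ** X ** \<Delta>"
    have \<Phi>: "psd \<Phi>" unfolding \<Phi>_def using s\<Delta> pos_def_psd[OF X(1)] by (rule psd_sym_congruence)
    define T where "T = c3 *\<^sub>R \<delta> - (\<Delta> + c2 *\<^sub>R \<Phi>)"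
    have "psd T"
    proof (rule psd_if_lyap_nonpos[OF lM])
      show "sym_mat T" unfolding T_def using s\<delta> s\<Delta> psd_sym[OF \<Phi>] by blast
      fix v
      define a where "a = \<Delta> *v v"
      define b where "b = \<delta> *v v"
      define p where "p = X *v a"
      define q where "q = \<Delta> *v p"
      have Mv: "M *v v = M0 *v v + (W *v a - S *v a) - W *v b"
        by (simp add: M_eq matrix_vector_algebra a_def b_def)
      have q1: "2 * (a \<bullet> (M0 *v v)) + (a \<bullet> (W *v a) - a \<bullet> (S *v a)) = - (v \<bullet> (Y *v v))"
      proof -
        have "v \<bullet> ((lyap M0 \<Delta> + \<Delta> ** (W - S) ** \<Delta>) *v v) =
            2 * (a \<bullet> (M0 *v v)) + (a \<bullet> (W *v a) - a \<bullet> (S *v a))"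
          by (simp only: matrix_vector_mult_add_rdistrib inner_add_right lyap_form[OF s\<Delta>]
              sandwich_bilinear_form[OF s\<Delta>] a_def matrix_vector_mult_diff_rdistrib inner_diff_right)
        then show ?thesis by (simp add: e1 matrix_vector_uminus)
      qed
      \<comment> \<open>The equation for \<Delta> polarised at p = X a. By the choice of X, its term
        (M0 p) . a is -|a|^2 / 2, the source of the positive square in the image of \<Phi>.\<close>
      have q1': "(M0 *v p) \<bullet> a + q \<bullet> (M0 *v v) + (q \<bullet> (W *v a) - q \<bullet> (S *v a)) = - (p \<bullet> (Y *v v))"
      proof -
        have "p \<bullet> ((lyap M0 \<Delta> + \<Delta> ** (W - S) ** \<Delta>) *v v) =
            (M0 *v p) \<bullet> a + q \<bullet> (M0 *v v) + (q \<bullet> (W *v a) - q \<bullet> (S *v a))"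
          by (simp only: matrix_vector_mult_add_rdistrib inner_add_right lyap_bilinear_form[OF s\<Delta>]
              sandwich_bilinear_form[OF s\<Delta>] a_def q_def matrix_vector_mult_diff_rdistrib inner_diff_right)
        then show ?thesis by (simp add: e1 matrix_vector_uminus)
      qed
      have l\<delta>: "v \<bullet> (lyap M \<delta> *v v) = - (v \<bullet> (Y *v v)) - b \<bullet> (W *v b)"
      proof -
        have "lyap M \<delta> = - Y - \<delta> ** W ** \<delta>" using e2 by (simp add: eq_diff_eq)
        then show ?thesis
          by (simp only: matrix_vector_mult_diff_rdistrib matrix_vector_uminus inner_diff_right
              inner_minus_right sandwich_bilinear_form[OF s\<delta>] b_def)
      qed
      have l\<Delta>: "v \<bullet> (lyap M \<Delta> *v v) = - (v \<bullet> (Y *v v)) + a \<bullet> (W *v a) - a \<bullet> (S *v a) - 2 * (a \<bullet> (W *v b))"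
        using q1 unfolding lyap_form[OF s\<Delta>] Mv a_def[symmetric]
        by (simp add: inner_add_right inner_diff_right)
      have \<Phi>v: "\<Phi> *v v = q"
        by (simp only: \<Phi>_def q_def p_def a_def matrix_vector_mul_assoc[symmetric])
      have l\<Phi>: "v \<bullet> (lyap M \<Phi> *v v) = (norm a)\<^sup>2 - 2 * (p \<bullet> (Y *v v)) - 2 * (q \<bullet> (W *v b))"
        using q1' Xa[of a] unfolding lyap_form[OF psd_sym[OF \<Phi>]] Mv \<Phi>v p_def[symmetric]
        by (simp add: inner_add_right inner_diff_right)
      have np: "norm p \<le> \<xi> * norm a" unfolding p_def by (rule \<xi>(2))
      have nq: "norm q \<le> d * (\<xi> * norm a)"
        unfolding q_def using d[of p] np \<open>d > 0\<close> by (meson mult_left_mono less_imp_le order_trans)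
      have Yform: "u \<bullet> (Y *v u) \<le> y * (norm u)\<^sup>2" for u
      proof -
        let ?a = "\<Delta> *v u"
        have "u \<bullet> ((lyap M0 \<Delta> + \<Delta> ** (W - S) ** \<Delta>) *v u) =
            2 * (?a \<bullet> (M0 *v u)) + (?a \<bullet> (W *v ?a) - ?a \<bullet> (S *v ?a))"
          by (simp only: matrix_vector_mult_add_rdistrib inner_add_right lyap_form[OF s\<Delta>]
              sandwich_bilinear_form[OF s\<Delta>] matrix_vector_mult_diff_rdistrib inner_diff_right)
        then have "u \<bullet> (Y *v u) = - (2 * (?a \<bullet> (M0 *v u))) - ?a \<bullet> (W *v ?a) + ?a \<bullet> (S *v ?a)"
          by (simp add: e1 matrix_vector_uminus)
        also have "\<dots> \<le> 2 * (norm ?a * norm (M0 *v u)) + s * (norm ?a)\<^sup>2"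
          using Cauchy_Schwarz_ineq2[of ?a "M0 *v u"] psdD[OF W, of ?a] form_le[OF s(2), of ?a] by linarith
        also have "\<dots> \<le> 2 * ((d * norm u) * (m * norm u)) + s * (d * norm u)\<^sup>2"
          using d[of u] m(2)[of u] \<open>d > 0\<close> m(1) s(1) by (intro add_mono mult_left_mono mult_mono power_mono) auto
        also have "\<dots> \<le> y * (norm u)\<^sup>2"
          using w(1) \<open>d > 0\<close> by (simp add: y_def power2_eq_square algebra_simps)
        finally show ?thesis .
      qed
      have bY: "2 * (p \<bullet> (Y *v v)) \<le> (norm a)\<^sup>2 / 4 + 4 * y * \<xi>\<^sup>2 * (v \<bullet> (Y *v v))"
      proof -
        \<comment> \<open>Tuned so that the p-part costs exactly a quarter of |a|^2; the W-term
          below takes the other quarter.\<close>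
        define \<epsilon> where "\<epsilon> = 1 / (4 * y * \<xi>\<^sup>2)"
        have "\<epsilon> > 0" using \<open>y > 0\<close> \<xi>(1) by (simp add: \<epsilon>_def)
        have "p \<bullet> (Y *v p) \<le> y * (\<xi> * norm a)\<^sup>2"
          using Yform[of p] np \<open>y > 0\<close> by (meson less_imp_le mult_left_mono norm_ge_zero order_trans power_mono)
        then have "\<epsilon> * (p \<bullet> (Y *v p)) \<le> \<epsilon> * (y * (\<xi> * norm a)\<^sup>2)" using \<open>\<epsilon> > 0\<close> by simp
        also have "\<dots> = (norm a)\<^sup>2 / 4" using \<open>y > 0\<close> \<xi>(1) by (simp add: \<epsilon>_def power_mult_distrib)
        finally have "\<epsilon> * (p \<bullet> (Y *v p)) \<le> (norm a)\<^sup>2 / 4" .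
        moreover have "(v \<bullet> (Y *v v)) / \<epsilon> = 4 * y * \<xi>\<^sup>2 * (v \<bullet> (Y *v v))" by (simp add: \<epsilon>_def)
        ultimately show ?thesis
          using psd_cauchy_schwarz_eps[OF Y \<open>\<epsilon> > 0\<close>, of p v] by linarith
      qed
      have bW: "2 * (q \<bullet> (W *v b)) \<le> (norm a)\<^sup>2 / 4 + 4 * w * d\<^sup>2 * \<xi>\<^sup>2 * (b \<bullet> (W *v b))"
      proof -
        define \<epsilon> where "\<epsilon> = 1 / (4 * w * d\<^sup>2 * \<xi>\<^sup>2)"
        have "\<epsilon> > 0" using w(1) \<open>d > 0\<close> \<xi>(1) by (simp add: \<epsilon>_def)
        have "q \<bullet> (W *v q) \<le> w * (d * (\<xi> * norm a))\<^sup>2"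
          using form_le[OF w(2), of q] nq w(1) by (meson less_imp_le mult_left_mono norm_ge_zero order_trans power_mono)
        then have "\<epsilon> * (q \<bullet> (W *v q)) \<le> \<epsilon> * (w * (d * (\<xi> * norm a))\<^sup>2)" using \<open>\<epsilon> > 0\<close> by simp
        also have "\<dots> = (norm a)\<^sup>2 / 4" using w(1) \<open>d > 0\<close> \<xi>(1) by (simp add: \<epsilon>_def power_mult_distrib)
        finally have "\<epsilon> * (q \<bullet> (W *v q)) \<le> (norm a)\<^sup>2 / 4" .
        moreover have "(b \<bullet> (W *v b)) / \<epsilon> = 4 * w * d\<^sup>2 * \<xi>\<^sup>2 * (b \<bullet> (W *v b))" by (simp add: \<epsilon>_def)
        ultimately show ?thesis
          using psd_cauchy_schwarz_eps[OF W \<open>\<epsilon> > 0\<close>, of q b] by linarith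
      qed
      have nonneg: "0 \<le> v \<bullet> (Y *v v)" "0 \<le> b \<bullet> (W *v b)" using psdD Y W by blast+
      have L\<Phi>: "(norm a)\<^sup>2 / 2 - c1 * (v \<bullet> (Y *v v) + b \<bullet> (W *v b)) \<le> v \<bullet> (lyap M \<Phi> *v v)"
      proof -
        have "4 * y * \<xi>\<^sup>2 * (v \<bullet> (Y *v v)) \<le> c1 * (v \<bullet> (Y *v v))"
          "4 * w * d\<^sup>2 * \<xi>\<^sup>2 * (b \<bullet> (W *v b)) \<le> c1 * (b \<bullet> (W *v b))"
          using \<open>y > 0\<close> w(1) nonneg by (auto intro!: mult_right_mono simp: c1_def)
        then show ?thesis unfolding l\<Phi> using bY bW by (simp add: distrib_left)
      qed
      \<comment> \<open>The form of W at a absorbs its part of the cross term with b, so S is the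
        only source of a loss in |a|^2.\<close>
      have L\<Delta>: "- (v \<bullet> (Y *v v) + b \<bullet> (W *v b)) - s * (norm a)\<^sup>2 \<le> v \<bullet> (lyap M \<Delta> *v v)"
        unfolding l\<Delta> using psd_cauchy_schwarz_eps[OF W zero_less_one, of a b] form_le[OF s(2), of a] by simp
      have "c2 * ((norm a)\<^sup>2 / 2 - c1 * (v \<bullet> (Y *v v) + b \<bullet> (W *v b))) \<le> c2 * (v \<bullet> (lyap M \<Phi> *v v))"
        using L\<Phi> \<open>c2 > 0\<close> by simp
      then have "s * (norm a)\<^sup>2 - c2 * c1 * (v \<bullet> (Y *v v) + b \<bullet> (W *v b)) \<le> c2 * (v \<bullet> (lyap M \<Phi> *v v))"
        by (simp add: c2_def algebra_simps)
      moreover have "c3 * (v \<bullet> (lyap M \<delta> *v v)) =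
          - (v \<bullet> (Y *v v) + b \<bullet> (W *v b)) - c2 * c1 * (v \<bullet> (Y *v v) + b \<bullet> (W *v b))"
        unfolding l\<delta> by (simp add: c3_def algebra_simps)
      moreover have "v \<bullet> (lyap M T *v v) = c3 * (v \<bullet> (lyap M \<delta> *v v)) - v \<bullet> (lyap M \<Delta> *v v) - c2 * (v \<bullet> (lyap M \<Phi> *v v))"
        by (simp add: T_def lyap_diff lyap_add lyap_scaleR matrix_vector_algebra inner_diff_right inner_add_right)
      ultimately show "v \<bullet> (lyap M T *v v) \<le> 0" using L\<Delta> by linarith
    qed
    then have "0 \<le> c3 * trace \<delta> - (trace \<Delta> + c2 * trace \<Phi>)"
      using psd_trace_nonneg[of T] by (simp add: T_def trace_sub trace_add trace_scaleR)
    moreover have "0 \<le> c2 * trace \<Phi>" using psd_trace_nonneg[OF \<Phi>] \<open>c2 > 0\<close> by simp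
    ultimately have "trace \<Delta> \<le> c3 * trace \<delta>" by linarith
    moreover have "trace \<delta> = trace (P - P\<^sub>0) - trace (P' - P\<^sub>0)" by (simp add: \<delta>_def trace_sub)
    ultimately show "trace (P - P\<^sub>0) \<le> c3 * (trace (P - P\<^sub>0) - trace (P' - P\<^sub>0))" by (simp add: \<Delta>_def)
  qed
qed

end

text \<open>Each iterate is shown to stay in \<open>Kset\<close> because \<open>P_K\<close> is a
  definite description, justified only there. The rate is fixed before the sequence, so one \<alpha>
  serves all starting policies of \<open>Kset_h\<close>.\<close>

theorem theorem1:
  fixes A :: "real^'n^'n" and B :: "real^'m^'n" and C :: "real^'n^'p"
    and D :: "real^'q^'n" and E :: "real^'m^'p" and \<gamma> h :: real
  assumes "\<gamma> > 0"
    and "pos_def (transpose C ** C)"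
    and "transpose E ** C = 0"
    and "pos_def (transpose E ** E)"
    and "\<exists>P. is_Pstar A B C D E \<gamma> P"
    and "h > 0"
  shows "\<exists>\<alpha>::real. 0 \<le> \<alpha> \<and> \<alpha> < 1 \<and>
    (\<forall>Ks :: nat \<Rightarrow> real^'n^'m.
       Ks 0 \<in> Kset_h A B C D E \<gamma> h \<longrightarrow>
       (\<forall>p. Ks (Suc p) = matrix_inv (transpose E ** E) ** transpose B ** P_K A B C D E \<gamma> (Ks p)) \<longrightarrow>
       (\<forall>p. Ks p \<in> Kset A B C D E \<gamma> \<and>
            trace (P_K A B C D E \<gamma> (Ks (Suc p)) - P_star A B C D E \<gamma>)
              \<le> \<alpha> * trace (P_K A B C D E \<gamma> (Ks p) - P_star A B C D E \<gamma>)))"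
proof -
  define Q where "Q = transpose C ** C"
  define R where "R = transpose E ** E"
  define W where "W = inverse (\<gamma>\<^sup>2) *\<^sub>R (D ** transpose D)"
  have "psd W"
    using psd_gram[of "transpose D"] by (simp add: W_def transpose_transpose psd_scaleR)
  interpret game_riccati A B Q R W
    by unfold_locales (use assms \<open>psd W\<close> in \<open>simp_all add: Q_def R_def\<close>)
  have Pstar: "is_Pstar A B C D E \<gamma> P \<longleftrightarrow> pos_def P \<and> ric_sol A Q (W - S) P" for P
  proof -
    have "ric A Q (W - S) P = transpose A ** P + P ** A - P ** (S - W) ** P + Q"
      by (simp add: ric_def lyap_def matrix_algebra algebra_simps)
    moreover have "A + (W - S) ** P = A - (S - W) ** P" by (simp add: matrix_algebra)
    moreover have "B ** matrix_inv (transpose E ** E) ** transpose B = S" unfolding S_def by (simp add: R_def)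
    ultimately show ?thesis
      unfolding is_Pstar_def ric_sol_def hurwitz_iff_lstab W_def[symmetric] Q_def[symmetric]
      using pos_def_psd by auto
  qed
  obtain P\<^sub>0 where P0: "pos_def P\<^sub>0" "ric_sol A Q (W - S) P\<^sub>0" using assms(5) Pstar by blast
  have minimal: "psd (P - P')"
    if "ric_sol A Q (W - S) P'" "pos_def P" "\<And>x. x \<bullet> (ric A Q (W - S) P *v x) \<le> 0" for P P'
    using ric_sol_minimal[OF that(1) sym_V pos_def_psd[OF Q] that(2,3)] .
  \<comment> \<open>\<open>ric_sol_unique\<close> requires a semidefinite coefficient and
    \<open>W - S\<close> is indefinite, so uniqueness comes from applying minimality in both
    directions.\<close>
  have "P_star A B C D E \<gamma> = P\<^sub>0"
    unfolding P_star_def Pstar using P0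
  proof (intro the_equality)
    fix P assume "pos_def P \<and> ric_sol A Q (W - S) P"
    then show "P = P\<^sub>0"
      using P0 by (intro psd_antisym minimal) (auto simp: ric_sol_def)
  qed simp
  have cost: "transpose (C - E ** K) ** (C - E ** K) = Q + transpose K ** R ** K" for K
  proof -
    have "transpose C ** E = transpose (transpose E ** C)" by (simp add: matrix_algebra)
    then have "transpose C ** E = 0" by (simp add: assms(3) transpose_zero)
    then have "transpose C ** (E ** X) = 0" "transpose E ** C = 0" for X :: "real^'n^'m"
      using assms(3) by (simp_all add: matrix_mul_assoc)
    then show ?thesis by (simp add: Q_def R_def matrix_algebra)
  qed
  have P_K: "policy_sol K (P_K A B C D E \<gamma> K)" if "K \<in> Kset A B C D E \<gamma>" for K
  proof -
    have "policy_sol K P \<longleftrightarrow> pos_def P \<and>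
      transpose (A_K A B K) ** P + P ** A_K A B K + Q_K C E K
        + (inverse (\<gamma>\<^sup>2)) *\<^sub>R (P ** D ** transpose D ** P) = 0 \<and>
      hurwitz (A_K A B K + (inverse (\<gamma>\<^sup>2)) *\<^sub>R (D ** transpose D ** P))" for P
    proof -
      have "inverse (\<gamma>\<^sup>2) *\<^sub>R (P ** D ** transpose D ** P) = P ** W ** P"
        "inverse (\<gamma>\<^sup>2) *\<^sub>R (D ** transpose D ** P) = W ** P"
        by (simp_all add: W_def matrix_algebra)
      moreover have "policy_sol K P \<longleftrightarrow> psd P \<and>
          transpose (A - B ** K) ** P + P ** (A - B ** K) + (Q + transpose K ** R ** K) + P ** W ** P = 0 \<and>
          lstab (A - B ** K + W ** P)"
        by (simp only: policy_sol_def ric_sol_def ric_def lyap_def)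
      ultimately show ?thesis
        using policy_sol_props(1)[of K P] pos_def_psd[of P]
        unfolding A_K_def Q_K_def hurwitz_iff_lstab Q_def[symmetric] R_def[symmetric] by auto
    qed
    then have the: "P_K A B C D E \<gamma> K = (THE P. policy_sol K P)" by (simp add: P_K_def)
    have "lstab (A - B ** K)" "l2_gain_below (A - B ** K) D (C - E ** K) \<gamma>"
      using that by (auto simp: Kset_iff A_K_def)
    moreover have "pos_def (transpose (C - E ** K) ** (C - E ** K))"
      unfolding cost by (rule pos_def_policy_cost)
    ultimately have "\<exists>P. policy_sol K P"
      using bounded_real[of "A - B ** K" "C - E ** K" \<gamma> D] assms(1)
      unfolding cost policy_sol_def W_def[symmetric] by blast
    then obtain P where "policy_sol K P" ..
    then show ?thesis unfolding the
    proof (rule theI)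
      fix P' assume "policy_sol K P'"
      then show "P' = P" using \<open>policy_sol K P\<close> W ric_sol_unique unfolding policy_sol_def by blast
    qed
  qed
  have improve: "fb P \<in> Kset A B C D E \<gamma>" if "policy_sol K P" for K P
  proof -
    obtain X where X: "psd X" "neg_form (policy_ric (fb P) X)" using policy_improvement \<open>policy_sol K P\<close> by blast
    then have "neg_form (ric (A - B ** fb P) (transpose (C - E ** fb P) ** (C - E ** fb P))
        (inverse (\<gamma>\<^sup>2) *\<^sub>R (D ** transpose D)) X)"
      unfolding policy_ric_def cost W_def[symmetric] by simp
    then show ?thesis
      using bounded_real_converse[OF assms(1) X(1)] by (auto simp: Kset_iff A_K_def)
  qed
  obtain c where c: "c \<ge> 1"
    "\<And>K P P'. policy_sol K P \<Longrightarrow> policy_sol (fb P) P' \<Longrightarrow> trace (P - P\<^sub>0) \<le> h \<Longrightarrow>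
       trace (P - P\<^sub>0) \<le> c * (trace (P - P\<^sub>0) - trace (P' - P\<^sub>0))"
    using policy_iteration_contraction[OF P0(2) assms(6)] by blast
  define \<alpha> where "\<alpha> = 1 - 1 / c"
  have \<alpha>: "0 \<le> \<alpha>" "\<alpha> < 1" using c(1) by (auto simp: \<alpha>_def)
  let ?d = "\<lambda>K. trace (P_K A B C D E \<gamma> K - P_star A B C D E \<gamma>)"
  let ?next = "\<lambda>K. matrix_inv (transpose E ** E) ** transpose B ** P_K A B C D E \<gamma> K"
  have step: "?next K \<in> Kset_h A B C D E \<gamma> h \<and> ?d (?next K) \<le> \<alpha> * ?d K"
    if "K \<in> Kset_h A B C D E \<gamma> h" for K
  proof -
    have K: "K \<in> Kset A B C D E \<gamma>" "?d K \<le> h" using that by (auto simp: Kset_h_def)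
    let ?P = "P_K A B C D E \<gamma> K"
    have next_eq: "?next K = fb ?P" unfolding fb_def by (simp add: R_def)
    have sol: "policy_sol K ?P" using P_K K(1) by blast
    have K': "?next K \<in> Kset A B C D E \<gamma>" unfolding next_eq using improve sol by blast
    have "?d K \<le> c * (?d K - ?d (?next K))"
      using c(2)[OF sol] P_K[OF K'] K(2) by (simp add: next_eq \<open>P_star A B C D E \<gamma> = P\<^sub>0\<close>)
    then have "?d K / c \<le> ?d K - ?d (?next K)" using c(1) by (simp add: divide_le_eq mult.commute)
    then have le: "?d (?next K) \<le> \<alpha> * ?d K" by (simp add: \<alpha>_def algebra_simps)
    \<comment> \<open>Nonnegativity of the gap turns the contraction into monotone decrease, so the
      next policy remains in \<open>Kset_h\<close> and the same constant applies again.\<close>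
    have "psd (?P - P\<^sub>0)"
    proof (rule minimal[OF P0(2) policy_sol_props(1)[OF sol]])
      have "psd (transpose (K - fb ?P) ** R ** (K - fb ?P))" using R by (intro psd_congruence pos_def_psd)
      then show "x \<bullet> (ric A Q (W - S) ?P *v x) \<le> 0" for x
        unfolding policy_sol_props(3)[OF sol] matrix_vector_uminus using psdD by fastforce
    qed
    then have "0 \<le> ?d K" using psd_trace_nonneg by (simp add: \<open>P_star A B C D E \<gamma> = P\<^sub>0\<close>)
    then have "\<alpha> * ?d K \<le> ?d K" using \<alpha> by (intro mult_left_le_one_le) auto
    then show ?thesis using K' le K(2) by (simp add: Kset_h_def)
  qed
  have "Ks p \<in> Kset A B C D E \<gamma> \<and> ?d (Ks (Suc p)) \<le> \<alpha> * ?d (Ks p)"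
    if "Ks 0 \<in> Kset_h A B C D E \<gamma> h" "\<forall>p. Ks (Suc p) = ?next (Ks p)" for Ks p
  proof -
    have "Ks p \<in> Kset_h A B C D E \<gamma> h"
    proof (induction p)
      case (Suc p)
      then show ?case using step that(2) by simp
    qed (rule that(1))
    then show ?thesis using step[of "Ks p"] that(2) by (auto simp: Kset_h_def)
  qed
  then show ?thesis using \<alpha> by blast
qed

end
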